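(* Let $X_1,\ldots,X_n$ be independent random variables with values in a Polish space $\mathcal{X}$, and let $\mathcal{S}$ be a nonempty countable class of measurable functions $s=(s^1,\ldots,s^n)$ from $\mathcal{X}$ into $[-1,1]^n$. Suppose that $\mathbb{E}(s^k(X_k))=0$ for any $s=(s^1,\ldots,s^n)\in\mathcal{S}$ and any integer $k\in[1,n]$. Let $S_n(s)=s^1(X_1)+\cdots+s^n(X_n)$, $Z=\sup\{S_n(s):s\in\mathcal{S}\}$, $V_n=\sup_{s\in\mathcal{S}}\operatorname{Var}S_n(s)$, $v=2\mathbb{E}(Z)+V_n$, and let $L(u)=\log\mathbb{E}(\exp(uZ))$ for real $u$. Then: (a) for any $t>0$, $$L(-t)\le -t\,\mathbb{E}(Z)+\frac{v}{9}\bigl(e^{3t}-3t-1\bigr).$$ Consequently, for any $x>0$: (b) $$\mathbb{P}(Z\le\mathbb{E}(Z)-x)\le\exp\Bigl(-\frac{v}{9}\,h\Bigl(\frac{3x}{v}\Bigr)\Bigr),\qquad\text{where } h(x)=(1+x)\log(1+x)-x;$$ (c) $$\mathbb{P}(Z\le\mathbb{E}(Z)-x)\le\exp\Bigl(-\frac{x^2}{v+\sqrt{v^2+2vx}+x}\Bigr)\le\exp\Bigl(-\frac{x^2}{2v+2x}\Bigr).$$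
   Context: Each component $s^k$ is a measurable function from $\mathcal{X}$ into $[-1,1]$. The variables $X_k$ need not be identically distributed. In (b), if $v=0$ the right-hand side is read as its limit $0$ as $v\to0^+$. *)

theory Defs
  imports "HOL-Probability.Probability"
begin

text \<open>
  A vector-valued function \<open>s = (s\<^sup>1, \<dots>, s\<^sup>n)\<close> is encoded as \<open>s :: nat \<Rightarrow> 'a \<Rightarrow> real\<close>, with
  \<open>s k\<close> the component \<open>s\<^sup>k\<close>; only the indices in \<open>{1..n}\<close> matter.  Likewise for the variables \<open>X k\<close>.
\<close>

definition emp_sum ::
  "nat \<Rightarrow> (nat \<Rightarrow> 'w \<Rightarrow> 'a) \<Rightarrow> (nat \<Rightarrow> 'a \<Rightarrow> real) \<Rightarrow> 'w \<Rightarrow> real"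
  where "emp_sum n X s \<omega> = (\<Sum>k=1..n. s k (X k \<omega>))"

text \<open>
  The suprema below are suprema of reals.  They are genuine suprema when \<open>\<S>\<close> is nonempty and the
  components take values in \<open>[-1,1]\<close>, since the sets are then bounded.
\<close>

definition emp_sup ::
  "nat \<Rightarrow> (nat \<Rightarrow> 'w \<Rightarrow> 'a) \<Rightarrow> (nat \<Rightarrow> 'a \<Rightarrow> real) set \<Rightarrow> 'w \<Rightarrow> real"
  where "emp_sup n X \<S> \<omega> = (SUP s\<in>\<S>. emp_sum n X s \<omega>)"

definition max_variance ::
  "'w measure \<Rightarrow> nat \<Rightarrow> (nat \<Rightarrow> 'w \<Rightarrow> 'a) \<Rightarrow> (nat \<Rightarrow> 'a \<Rightarrow> real) set \<Rightarrow> real"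
  where "max_variance M n X \<S> = (SUP s\<in>\<S>. prob_space.variance M (emp_sum n X s))"

definition var_factor ::
  "'w measure \<Rightarrow> nat \<Rightarrow> (nat \<Rightarrow> 'w \<Rightarrow> 'a) \<Rightarrow> (nat \<Rightarrow> 'a \<Rightarrow> real) set \<Rightarrow> real"
  where "var_factor M n X \<S> =
    2 * prob_space.expectation M (emp_sup n X \<S>) + max_variance M n X \<S>"

definition log_laplace :: "'w measure \<Rightarrow> ('w \<Rightarrow> real) \<Rightarrow> real \<Rightarrow> real"
  where "log_laplace M Z u = ln (prob_space.expectation M (\<lambda>\<omega>. exp (u * Z \<omega>)))"

definition bennett_h :: "real \<Rightarrow> real"
  where "bennett_h x = (1 + x) * ln (1 + x) - x"

text \<open>
  At \<open>v = 0\<close> the expression is read as its limit \<open>0\<close> as \<open>v\<close> tends to \<open>0\<close> from the right.  The case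
  distinction is needed: with \<open>x / 0 = 0\<close> the formula would give \<open>1\<close>.
\<close>

definition bennett_bound :: "real \<Rightarrow> real \<Rightarrow> real"
  where "bennett_bound v x = (if v = 0 then 0 else exp (- (v / 9) * bennett_h (3 * x / v)))"

end

theory Submission
  imports Defs
begin

text \<open>
  Let \<open>f = exp (- t Z)\<close>. By tensorization, the entropy of \<open>f\<close> is at most the sum of the expected
  entropies along single coordinates. Along coordinate \<open>k\<close> let \<open>m\<close> be the mean of \<open>f\<close>. For each
  \<open>s\<close>, comparing \<open>f\<close> with the larger function \<open>exp (- t S\<^sub>n(s))\<close> gives
  \<open>H + \<phi> m \<le> exp (- t c) (\<phi> + \<sigma>\<^sup>2 B)\<close>, where \<open>H\<close> is the coordinate entropy,
  \<open>c = S\<^sub>n(s) - s\<^sup>k\<close>, \<open>\<sigma>\<^sup>2\<close> is the variance of \<open>s\<^sup>k\<close> and \<open>\<phi> = exp t - 1\<close>, \<open>B\<close> depend only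
  on \<open>t\<close>. Taking logarithms makes this linear in \<open>c\<close> and \<open>\<sigma>\<^sup>2\<close>, so it can be summed over \<open>k\<close> for an
  almost maximizing \<open>s\<close>: the terms \<open>s\<^sup>k\<close> add up to \<open>Z\<close> and the variances to at most \<open>V\<^sub>n\<close>. This
  yields a linear differential inequality for \<open>L(-t)\<close>, of which the right-hand side of (a) is a
  supersolution for \<open>t \<le> 11/20\<close>. For larger \<open>t\<close> the bound \<open>Z \<ge> S\<^sub>n(s)\<close> for a single \<open>s\<close> suffices.
\<close>

subsection \<open>Elementary bounds on the exponential function\<close>

lemma nonneg_if_deriv_nonneg:
  fixes F F' :: "real \<Rightarrow> real"
  assumes "\<And>x. 0 \<le> x \<Longrightarrow> x \<le> t \<Longrightarrow> (F has_real_derivative F' x) (at x)"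
    and "\<And>x. 0 \<le> x \<Longrightarrow> x \<le> t \<Longrightarrow> 0 \<le> F' x" and "F 0 = 0" and "0 \<le> t"
  shows "0 \<le> F t"
proof -
  have "F 0 \<le> F t"
    by (rule DERIV_nonneg_imp_nondecreasing[OF \<open>0 \<le> t\<close>]) (use assms in blast)
  then show ?thesis using assms by simp
qed

text \<open>In \<open>t\<close>, the difference of the two sides and its first derivative vanish at
  0, and the second derivative is \<open>s\<^sup>2 * (exp t - exp (t * s))\<close>, nonnegative
  because \<open>t * s \<le> t\<close>. Integrated against a centered \<open>s\<close>, only the
  second moment remains.\<close>

lemma exp_scaled_le:
  fixes s t :: real
  assumes "\<bar>s\<bar> \<le> 1" "0 \<le> t"
  shows "exp (t * s) \<le> 1 + t * s + s\<^sup>2 * (exp t - 1 - t)"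
proof -
  have le: "t * s \<le> t" if "0 \<le> t" for t
    using assms(1) that mult_left_mono[of s 1 t] by simp
  have 0: "0 \<le> s\<^sup>2 * (exp t - exp (t * s))" if "0 \<le> t" for t
    using le[OF that] by simp
  have 1: "0 \<le> s\<^sup>2 * (exp t - 1) - s * (exp (t * s) - 1)" if "0 \<le> t" for t
    by (rule nonneg_if_deriv_nonneg[where t = t and F' = "\<lambda>t. s\<^sup>2 * (exp t - exp (t * s))"])
      (auto intro!: derivative_eq_intros 0 that simp del: zero_le_mult_iff,
       auto simp: algebra_simps power2_eq_square)
  have "0 \<le> s\<^sup>2 * (exp t - 1 - t) - (exp (t * s) - 1 - t * s)"
    by (rule nonneg_if_deriv_nonneg[where t = t and F' = "\<lambda>t. s\<^sup>2 * (exp t - 1) - s * (exp (t * s) - 1)"])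
      (use assms 1 in \<open>auto intro!: derivative_eq_intros simp: algebra_simps\<close>)
  then show ?thesis by simp
qed

text \<open>The antiderivative of \<open>x * exp x\<close> vanishing at 0; equally
  \<open>x * p' x - p x\<close> for \<open>p x = exp x - x - 1\<close>.\<close>

definition entropy_fn :: "real \<Rightarrow> real"
  where "entropy_fn x = 1 + (x - 1) * exp x"

text \<open>Both sides vanish at \<open>t = 0\<close>, and their derivatives in \<open>t\<close> are
  \<open>s\<^sup>2 * t * exp (t * s)\<close> and \<open>s\<^sup>2 * t * exp t\<close>.\<close>

lemma entropy_fn_scaled_le:
  fixes s t :: real
  assumes "\<bar>s\<bar> \<le> 1" "0 \<le> t"
  shows "entropy_fn (t * s) \<le> s\<^sup>2 * entropy_fn t"
proof -
  have le: "t * s \<le> t" if "0 \<le> t" for t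
    using assms(1) that mult_left_mono[of s 1 t] by simp
  have 0: "0 \<le> s\<^sup>2 * (t * (exp t - exp (t * s)))" if "0 \<le> t" for t
    using le[OF that] that by simp
  have "0 \<le> s\<^sup>2 * entropy_fn t - entropy_fn (t * s)"
    unfolding entropy_fn_def
    by (rule nonneg_if_deriv_nonneg[where t = t and F' = "\<lambda>t. s\<^sup>2 * (t * (exp t - exp (t * s)))"])
      (auto intro!: derivative_eq_intros 0 assms simp del: zero_le_mult_iff,
       auto simp: algebra_simps power2_eq_square)
  then show ?thesis by simp
qed

lemma entropy_fn_ge:
  assumes "0 \<le> x"
  shows "x\<^sup>2 / 2 + x ^ 3 / 3 \<le> entropy_fn x"
proof -
  have 0: "0 \<le> x * (exp x - 1 - x)" if "0 \<le> x" for x :: real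
    using exp_ge_add_one_self[of x] that by (intro mult_nonneg_nonneg) linarith+
  have "0 \<le> entropy_fn x - (x\<^sup>2 / 2 + x ^ 3 / 3)"
    unfolding entropy_fn_def
    by (rule nonneg_if_deriv_nonneg[where t = x and F' = "\<lambda>x. x * (exp x - 1 - x)"])
      (auto intro!: derivative_eq_intros 0 assms simp del: zero_le_mult_iff,
       auto simp: algebra_simps power2_eq_square)
  then show ?thesis by simp
qed

lemma entropy_fn_nonneg:
  assumes "0 \<le> x" shows "0 \<le> entropy_fn x"
  using entropy_fn_ge[OF assms] assms by (smt (verit) divide_nonneg_pos zero_le_power)

lemma exp_ge_cubic:
  assumes "0 \<le> (x :: real)"
  shows "1 + x + x\<^sup>2 / 2 + x ^ 3 / 6 \<le> exp x"
proof -
  have "0 \<le> exp x - (1 + x + x\<^sup>2 / 2 + x ^ 3 / 6)"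
    by (rule nonneg_if_deriv_nonneg[where t = x and F' = "\<lambda>x. exp x - (1 + x + x\<^sup>2 / 2)"])
      (use assms exp_lower_Taylor_quadratic in \<open>auto intro!: derivative_eq_intros simp: algebra_simps power2_eq_square\<close>)
  then show ?thesis by simp
qed

subsection \<open>Entropy of a positive function\<close>

definition ent :: "'a measure \<Rightarrow> ('a \<Rightarrow> real) \<Rightarrow> real"
  where "ent M f = (\<integral>x. f x * ln (f x) \<partial>M) - (\<integral>x. f x \<partial>M) * ln (\<integral>x. f x \<partial>M)"

lemma abs_mult_ln_le:
  fixes a b x y :: real
  assumes "0 < a" "a \<le> x" "x \<le> b" "a \<le> y" "y \<le> b"
  shows "\<bar>x * ln y\<bar> \<le> b * (\<bar>ln a\<bar> + \<bar>ln b\<bar>)"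
proof -
  have "ln a \<le> ln y" "ln y \<le> ln b" using assms by auto
  then have "\<bar>ln y\<bar> \<le> \<bar>ln a\<bar> + \<bar>ln b\<bar>" by linarith
  then show ?thesis
    unfolding abs_mult using assms by (intro mult_mono) auto
qed

context prob_space
begin

lemma integrable_bounded:
  fixes f :: "'a \<Rightarrow> real"
  assumes "f \<in> borel_measurable M" "\<And>x. x \<in> space M \<Longrightarrow> \<bar>f x\<bar> \<le> C"
  shows "integrable M f"
  by (rule integrable_const_bound[where B = C]) (use assms in auto)

lemma integral_between:
  fixes f :: "'a \<Rightarrow> real"
  assumes "f \<in> borel_measurable M" "\<And>x. x \<in> space M \<Longrightarrow> a \<le> f x" "\<And>x. x \<in> space M \<Longrightarrow> f x \<le> b"
  shows "a \<le> (\<integral>x. f x \<partial>M)" "(\<integral>x. f x \<partial>M) \<le> b"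
proof -
  have "\<bar>f x\<bar> \<le> \<bar>a\<bar> + \<bar>b\<bar>" if "x \<in> space M" for x using assms(2,3)[of x] that by linarith
  then have "integrable M f" by (rule integrable_bounded[OF assms(1)])
  then show "a \<le> (\<integral>x. f x \<partial>M)" "(\<integral>x. f x \<partial>M) \<le> b"
    using integral_ge_const[of f a] integral_le_const[of f b] assms by auto
qed

lemma abs_integral_le:
  fixes f :: "'a \<Rightarrow> real"
  assumes "f \<in> borel_measurable M" "\<And>x. x \<in> space M \<Longrightarrow> \<bar>f x\<bar> \<le> C"
  shows "\<bar>\<integral>x. f x \<partial>M\<bar> \<le> C"
  using integral_between[OF assms(1), of "-C" C] assms(2) by (auto simp: abs_le_iff minus_le_iff)

lemma integrable_mult_ln:
  fixes f g :: "'a \<Rightarrow> real"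
  assumes "f \<in> borel_measurable M" "g \<in> borel_measurable M" "0 < a"
    and "\<And>x. x \<in> space M \<Longrightarrow> f x \<in> {a..b}" "\<And>x. x \<in> space M \<Longrightarrow> g x \<in> {a..b}"
  shows "integrable M (\<lambda>x. f x * ln (g x))"
  by (rule integrable_bounded[where C = "b * (\<bar>ln a\<bar> + \<bar>ln b\<bar>)"])
    (use assms in \<open>auto intro!: abs_mult_ln_le\<close>)

text \<open>One half of the variational formula for entropy. For fixed \<open>g\<close> the
  left-hand side is linear in \<open>f\<close>, from which the convexity of entropy follows.\<close>

lemma gibbs_inequality:
  fixes f g :: "'a \<Rightarrow> real"
  assumes [measurable]: "f \<in> borel_measurable M" "g \<in> borel_measurable M"
    and "0 < a" "\<And>x. x \<in> space M \<Longrightarrow> f x \<in> {a..b}" "\<And>x. x \<in> space M \<Longrightarrow> g x \<in> {a..b}"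
  shows "(\<integral>x. f x * ln (g x) \<partial>M) - (\<integral>x. f x \<partial>M) * ln (\<integral>x. g x \<partial>M) \<le> ent M f"
proof -
  let ?A = "\<integral>x. f x \<partial>M" and ?C = "\<integral>x. g x \<partial>M"
  have pos: "0 < f x" "0 < g x" if "x \<in> space M" for x
    using assms(3) assms(4,5)[OF that] by auto
  have AC: "0 < ?A" "0 < ?C"
    using integral_between[of f a b] integral_between[of g a b] assms by auto
  have [simp]: "integrable M f" "integrable M g"
    by (rule integrable_bounded[where C = b]; use assms in force)+
  have [simp]: "integrable M (\<lambda>x. f x * ln (g x))" "integrable M (\<lambda>x. f x * ln (f x))"
    by (rule integrable_mult_ln[where a = a and b = b]; use assms in simp)+
  \<comment> \<open>This is \<open>f x\<close> times \<open>ln z \<le> z - 1\<close> with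
    \<open>z = g x / ?C * (?A / f x)\<close>; dividing by the means makes the right-hand side
    integrate to 0.\<close>
  have "f x * ln (g x) - f x * ln ?C + f x * ln ?A - f x * ln (f x) \<le> ?A / ?C * g x - f x"
    if "x \<in> space M" for x
  proof -
    note pos = pos[OF that]
    have "ln (g x / ?C * (?A / f x)) \<le> g x / ?C * (?A / f x) - 1"
      using pos AC by (intro ln_le_minus_one) simp
    then have "f x * ln (g x / ?C * (?A / f x)) \<le> f x * (g x / ?C * (?A / f x) - 1)"
      using pos by (intro mult_left_mono) (auto simp: less_imp_le)
    also have "ln (g x / ?C * (?A / f x)) = ln (g x) - ln ?C + ln ?A - ln (f x)"
      using pos AC by (simp add: ln_mult ln_div)
    also have "f x * (g x / ?C * (?A / f x) - 1) = ?A / ?C * g x - f x"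
      using pos AC by (simp add: field_simps)
    finally show ?thesis by (simp add: algebra_simps)
  qed
  then have "(\<integral>x. f x * ln (g x) - f x * ln ?C + f x * ln ?A - f x * ln (f x) \<partial>M)
      \<le> (\<integral>x. ?A / ?C * g x - f x \<partial>M)"
    by (intro integral_mono) auto
  also have "\<dots> = 0" using AC by simp
  finally show ?thesis by (simp add: ent_def)
qed

lemma ent_nonneg:
  fixes f :: "'a \<Rightarrow> real"
  assumes "f \<in> borel_measurable M" "0 < a" "\<And>x. x \<in> space M \<Longrightarrow> f x \<in> {a..b}"
  shows "0 \<le> ent M f"
proof -
  obtain x where "x \<in> space M" using not_empty by blast
  then have "a \<le> b" using assms(3)[of x] by simp
  then show ?thesis
    using gibbs_inequality[of f "\<lambda>_. a" a b] assms by (simp add: prob_space)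
qed

lemma abs_ent_le:
  fixes f :: "'a \<Rightarrow> real"
  assumes [measurable]: "f \<in> borel_measurable M"
    and "0 < a" "\<And>x. x \<in> space M \<Longrightarrow> f x \<in> {a..b}"
  shows "\<bar>ent M f\<bar> \<le> 2 * (b * (\<bar>ln a\<bar> + \<bar>ln b\<bar>))"
proof -
  have "\<bar>\<integral>x. f x * ln (f x) \<partial>M\<bar> \<le> b * (\<bar>ln a\<bar> + \<bar>ln b\<bar>)"
    using assms by (intro abs_integral_le abs_mult_ln_le) auto
  moreover have "\<bar>(\<integral>x. f x \<partial>M) * ln (\<integral>x. f x \<partial>M)\<bar> \<le> b * (\<bar>ln a\<bar> + \<bar>ln b\<bar>)"
    using assms integral_between[of f a b] by (intro abs_mult_ln_le) auto
  ultimately show ?thesis by (simp add: ent_def)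
qed

end

text \<open>Convexity of entropy. Apply Gibbs' inequality to every \<open>h x\<close> with the
  average \<open>?F\<close> as test function; averaged over \<open>x\<close>, its left-hand side
  becomes the entropy of \<open>?F\<close> by Fubini.\<close>

lemma (in pair_prob_space) ent_integral_le:
  fixes h :: "'a \<Rightarrow> 'b \<Rightarrow> real"
  assumes meas[measurable]: "case_prod h \<in> borel_measurable (M1 \<Otimes>\<^sub>M M2)"
    and "0 < a" and h: "\<And>x y. x \<in> space M1 \<Longrightarrow> y \<in> space M2 \<Longrightarrow> h x y \<in> {a..b}"
  shows "ent M2 (\<lambda>y. \<integral>x. h x y \<partial>M1) \<le> (\<integral>x. ent M2 (h x) \<partial>M1)"
proof -
  let ?F = "\<lambda>y. \<integral>x. h x y \<partial>M1"
  let ?C = "\<integral>y. ?F y \<partial>M2"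
  let ?c = "b * (\<bar>ln a\<bar> + \<bar>ln b\<bar>)"
  have m1: "(\<lambda>x. h x y) \<in> borel_measurable M1" if "y \<in> space M2" for y
    using that by measurable
  have m2: "h x \<in> borel_measurable M2" if "x \<in> space M1" for x
    using that by measurable
  have F[measurable]: "?F \<in> borel_measurable M2"
    by (rule M1.borel_measurable_lebesgue_integral) measurable
  have Fab: "?F y \<in> {a..b}" if "y \<in> space M2" for y
    using M1.integral_between[OF m1[OF that], of a b] h[OF _ that] by auto
  have int: "integrable (M1 \<Otimes>\<^sub>M M2) (case_prod h)"
    by (rule P.integrable_bounded[where C = b])
      (use h \<open>0 < a\<close> in \<open>force simp: space_pair_measure\<close>)+
  have intF: "integrable (M1 \<Otimes>\<^sub>M M2) (\<lambda>(x, y). h x y * ln (?F y))"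
    by (rule P.integrable_bounded[where C = ?c])
      (use h Fab \<open>0 < a\<close> in \<open>auto simp: space_pair_measure intro!: abs_mult_ln_le\<close>)
  have intE: "integrable M1 (\<lambda>x. ent M2 (h x))"
    unfolding ent_def
    by (rule M1.integrable_bounded[where C = "2 * ?c"], measurable)
      (use M2.abs_ent_le[OF m2 \<open>0 < a\<close>] h in \<open>auto simp: ent_def\<close>)
  have "ent M2 ?F = (\<integral>y. \<integral>x. h x y * ln (?F y) \<partial>M1 \<partial>M2) - (\<integral>y. \<integral>x. h x y \<partial>M1 \<partial>M2) * ln ?C"
    by (simp add: ent_def)
  also have "\<dots> = (\<integral>x. (\<integral>y. h x y * ln (?F y) \<partial>M2) \<partial>M1) - (\<integral>x. (\<integral>y. h x y \<partial>M2) \<partial>M1) * ln ?C"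
    using Fubini_integral[OF int] Fubini_integral[OF intF] by simp
  also have "\<dots> = (\<integral>x. (\<integral>y. h x y * ln (?F y) \<partial>M2) - (\<integral>y. h x y \<partial>M2) * ln ?C \<partial>M1)"
    using integrable_fst[OF int] integrable_fst[OF intF] by simp
  also have "\<dots> \<le> (\<integral>x. ent M2 (h x) \<partial>M1)"
  proof (rule integral_mono)
    show "integrable M1 (\<lambda>x. (\<integral>y. h x y * ln (?F y) \<partial>M2) - (\<integral>y. h x y \<partial>M2) * ln ?C)"
      using integrable_fst[OF int] integrable_fst[OF intF] by simp
    show "(\<integral>y. h x y * ln (?F y) \<partial>M2) - (\<integral>y. h x y \<partial>M2) * ln ?C \<le> ent M2 (h x)"
      if "x \<in> space M1" for x
      by (rule M2.gibbs_inequality[OF m2[OF that] F \<open>0 < a\<close>]) (use h that Fab in auto)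
  qed (rule intE)
  finally show ?thesis .
qed

section \<open>Finite product measures and the tensorization of entropy\<close>

lemma measurable_comp_fun_upd:
  assumes "f \<in> borel_measurable (Pi\<^sub>M (insert i J) M)"
  shows "(\<lambda>(x, y). f (x(i := y))) \<in> borel_measurable (Pi\<^sub>M J M \<Otimes>\<^sub>M M i)"
  using measurable_compose[OF measurable_add_dim assms] by (simp add: case_prod_beta')

lemma borel_measurable_ent:
  assumes "prob_space N" "(\<lambda>(x, y). g x y) \<in> borel_measurable (L \<Otimes>\<^sub>M N)"
  shows "(\<lambda>x. ent N (g x)) \<in> borel_measurable L"
proof -
  interpret prob_space N by fact
  note assms(2)[measurable]
  show ?thesis unfolding ent_def by measurable
qed

lemma fun_upd_in_space_PiM:
  assumes "x \<in> space (Pi\<^sub>M J M)" "y \<in> space (M i)" "insert i J = I"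
  shows "x(i := y) \<in> space (Pi\<^sub>M I M)"
  using assms by (auto simp: space_PiM PiE_def extensional_def)

text \<open>All indices carry a probability measure, also those outside the finite sets over which
  products are taken, since \<open>product_sigma_finite\<close> constrains the whole family.\<close>

locale finite_product_prob =
  fixes M :: "'i \<Rightarrow> 'a measure"
  assumes prob[intro, simp]: "\<And>i. prob_space (M i)"
begin

sublocale product_sigma_finite M
  by (intro product_sigma_finite.intro prob_space_imp_sigma_finite prob)

lemma prob_PiM[intro, simp]: "prob_space (Pi\<^sub>M I M)"
  by (intro prob_space_PiM prob)

lemma integral_insert:
  fixes f :: "('i \<Rightarrow> 'a) \<Rightarrow> real"
  assumes "finite J" "i \<notin> J" "f \<in> borel_measurable (Pi\<^sub>M (insert i J) M)"
    and "\<And>x. x \<in> space (Pi\<^sub>M (insert i J) M) \<Longrightarrow> \<bar>f x\<bar> \<le> C"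
  shows "(\<integral>x. f x \<partial>Pi\<^sub>M (insert i J) M) = (\<integral>x. (\<integral>y. f (x(i := y)) \<partial>M i) \<partial>Pi\<^sub>M J M)"
  by (intro product_integral_insert assms prob_space.integrable_bounded[where C = C] prob_PiM)

text \<open>The tower property: integrating \<open>f (x(k := y))\<close> over \<open>y\<close> is
  the conditional expectation given the other coordinates, kept as a function on the full product so
  that different \<open>k\<close> can be compared.\<close>

lemma integral_resample:
  fixes f :: "('i \<Rightarrow> 'a) \<Rightarrow> real"
  assumes "finite I" "k \<in> I" "f \<in> borel_measurable (Pi\<^sub>M I M)"
    and bd: "\<And>x. x \<in> space (Pi\<^sub>M I M) \<Longrightarrow> \<bar>f x\<bar> \<le> C"
  shows "(\<integral>x. f x \<partial>Pi\<^sub>M I M) = (\<integral>x. (\<integral>y. f (x(k := y)) \<partial>M k) \<partial>Pi\<^sub>M I M)"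
proof -
  interpret k: prob_space "M k" by simp
  obtain J where J: "I = insert k J" "k \<notin> J" "finite J"
    using assms by (metis finite_insert mk_disjoint_insert)
  have m: "(\<lambda>(x, y). f (x(k := y))) \<in> borel_measurable (Pi\<^sub>M I M \<Otimes>\<^sub>M M k)"
    by (rule measurable_comp_fun_upd) (use J assms in \<open>simp add: insert_absorb\<close>)
  have bd': "\<bar>\<integral>y. f (x(k := y)) \<partial>M k\<bar> \<le> C" if "x \<in> space (Pi\<^sub>M I M)" for x
    by (rule k.abs_integral_le)
      (use measurable_Pair2[OF m that] bd fun_upd_in_space_PiM[OF that] \<open>k \<in> I\<close>
        in \<open>auto simp: insert_absorb\<close>)
  \<comment> \<open>The second update at \<open>k\<close> overwrites the first, so the integral over
    \<open>z\<close> is that of a constant.\<close>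
  have "(\<integral>x. (\<integral>y. f (x(k := y)) \<partial>M k) \<partial>Pi\<^sub>M I M)
      = (\<integral>x. (\<integral>z. (\<integral>y. f (x(k := z, k := y)) \<partial>M k) \<partial>M k) \<partial>Pi\<^sub>M J M)"
    unfolding J(1)
    by (rule integral_insert[OF J(3,2)])
      (use bd' M.borel_measurable_lebesgue_integral[OF m] J(1) in auto)
  also have "\<dots> = (\<integral>x. f x \<partial>Pi\<^sub>M I M)"
    using integral_insert[OF J(3,2), of f C] assms J(1) by (simp add: k.prob_space)
  finally show ?thesis ..
qed

text \<open>Induction on the index set. The chain rule splits off the entropy along the new
  coordinate \<open>i\<close> and leaves the entropy of the average \<open>F\<close> over that
  coordinate; the induction hypothesis applies to \<open>F\<close>, and convexity moves the average
  outside each coordinate entropy.\<close>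

theorem ent_tensorization:
  fixes f :: "('i \<Rightarrow> 'a) \<Rightarrow> real"
  assumes "finite I" "f \<in> borel_measurable (Pi\<^sub>M I M)" "0 < a"
    and "\<And>x. x \<in> space (Pi\<^sub>M I M) \<Longrightarrow> f x \<in> {a..b}"
  shows "ent (Pi\<^sub>M I M) f \<le> (\<Sum>k\<in>I. \<integral>x. ent (M k) (\<lambda>y. f (x(k := y))) \<partial>Pi\<^sub>M I M)"
  using assms(1,2,4)
proof (induction I arbitrary: f rule: finite_induct)
  case empty
  then show ?case
    by (simp add: PiM_empty ent_def lebesgue_integral_count_space_finite)
next
  case (insert i J)
  note f = insert.prems(1) and fab = insert.prems(2)
  let ?I = "insert i J" and ?c = "b * (\<bar>ln a\<bar> + \<bar>ln b\<bar>)"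
  interpret i: prob_space "M i" by simp
  interpret J: prob_space "Pi\<^sub>M J M" by simp
  define F where "F x = (\<integral>y. f (x(i := y)) \<partial>M i)" for x
  have m: "(\<lambda>(x, y). f (x(i := y))) \<in> borel_measurable (Pi\<^sub>M J M \<Otimes>\<^sub>M M i)"
    by (rule measurable_comp_fun_upd[OF f])
  have F: "F \<in> borel_measurable (Pi\<^sub>M J M)"
    unfolding F_def by (rule M.borel_measurable_lebesgue_integral[OF m])
  have mi: "(\<lambda>y. f (x(i := y))) \<in> borel_measurable (M i)" if "x \<in> space (Pi\<^sub>M J M)" for x
    using measurable_Pair2[OF m that] by simp
  have fi: "f (x(i := y)) \<in> {a..b}" if "x \<in> space (Pi\<^sub>M J M)" "y \<in> space (M i)" for x y
    using fab fun_upd_in_space_PiM[OF that] by blast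
  have Fab: "F x \<in> {a..b}" if "x \<in> space (Pi\<^sub>M J M)" for x
    unfolding F_def using i.integral_between[OF mi[OF that], of a b] fi[OF that] by auto
  have e: "\<bar>ent (M k) (\<lambda>y. f (x(k := y)))\<bar> \<le> 2 * ?c"
    if "k \<in> ?I" "x \<in> space (Pi\<^sub>M ?I M)" for k x
  proof -
    have "insert k ?I = ?I" using that by auto
    then have "(\<lambda>(x, y). f (x(k := y))) \<in> borel_measurable (Pi\<^sub>M ?I M \<Otimes>\<^sub>M M k)"
      by (intro measurable_comp_fun_upd) (simp add: f)
    from measurable_Pair2[OF this that(2)] show ?thesis
      by (intro prob_space.abs_ent_le[OF prob] \<open>0 < a\<close> fab fun_upd_in_space_PiM[OF that(2)])
        (use \<open>insert k ?I = ?I\<close> in auto)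
  qed
  have me: "(\<lambda>x. ent (M k) (\<lambda>y. f (x(k := y)))) \<in> borel_measurable (Pi\<^sub>M ?I M)"
    if "k \<in> ?I" for k
    using that by (intro borel_measurable_ent measurable_comp_fun_upd) (auto simp: insert_absorb f)
  \<comment> \<open>The chain rule: the integrals of \<open>F x * ln (F x)\<close> cancel between
    the two terms.\<close>
  have "ent (Pi\<^sub>M ?I M) f = (\<integral>x. ent (M i) (\<lambda>y. f (x(i := y))) \<partial>Pi\<^sub>M J M) + ent (Pi\<^sub>M J M) F"
  proof -
    have "\<bar>f x\<bar> \<le> b" if "x \<in> space (Pi\<^sub>M ?I M)" for x
      using fab[OF that] \<open>0 < a\<close> by auto
    then have 1: "(\<integral>x. f x \<partial>Pi\<^sub>M ?I M) = (\<integral>x. F x \<partial>Pi\<^sub>M J M)"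
      unfolding F_def by (rule integral_insert[OF insert.hyps f])
    have *: "\<bar>f x * ln (f x)\<bar> \<le> ?c" if "x \<in> space (Pi\<^sub>M ?I M)" for x
      using fab[OF that] \<open>0 < a\<close> by (intro abs_mult_ln_le) auto
    have 2: "(\<integral>x. f x * ln (f x) \<partial>Pi\<^sub>M ?I M)
        = (\<integral>x. (\<integral>y. f (x(i := y)) * ln (f (x(i := y))) \<partial>M i) \<partial>Pi\<^sub>M J M)"
      by (rule integral_insert[OF insert.hyps _ *]) (use f in simp)
    have 3: "(\<integral>y. f (x(i := y)) * ln (f (x(i := y))) \<partial>M i)
        = ent (M i) (\<lambda>y. f (x(i := y))) + F x * ln (F x)" for x
      by (simp add: ent_def F_def)
    have 4: "integrable (Pi\<^sub>M J M) (\<lambda>x. ent (M i) (\<lambda>y. f (x(i := y))))"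
      by (rule J.integrable_bounded[where C = "2 * ?c"])
        (use borel_measurable_ent[OF prob m] i.abs_ent_le[OF mi \<open>0 < a\<close> fi] in auto)
    have 5: "integrable (Pi\<^sub>M J M) (\<lambda>x. F x * ln (F x))"
      by (rule J.integrable_mult_ln[OF F F \<open>0 < a\<close> Fab Fab])
    show ?thesis
      using 4 5 by (simp add: ent_def[of "Pi\<^sub>M ?I M"] 1 2 3 ent_def[of "Pi\<^sub>M J M"])
  qed
  \<comment> \<open>The entropy along \<open>i\<close> does not depend on the coordinate
    \<open>i\<close> of \<open>x\<close>, so integrating over that coordinate as well changes
    nothing.\<close>
  moreover have "(\<integral>x. ent (M i) (\<lambda>y. f (x(i := y))) \<partial>Pi\<^sub>M J M)
      = (\<integral>x. ent (M i) (\<lambda>y. f (x(i := y))) \<partial>Pi\<^sub>M ?I M)"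
    using integral_insert[OF insert.hyps me[of i], of "2 * ?c"] e[of i]
    by (simp add: i.prob_space)
  moreover have "ent (Pi\<^sub>M J M) F \<le> (\<Sum>k\<in>J. \<integral>x. ent (M k) (\<lambda>z. F (x(k := z))) \<partial>Pi\<^sub>M J M)"
    by (rule insert.IH[OF F Fab])
  moreover have "(\<Sum>k\<in>J. \<integral>x. ent (M k) (\<lambda>z. F (x(k := z))) \<partial>Pi\<^sub>M J M)
      \<le> (\<Sum>k\<in>J. \<integral>x. ent (M k) (\<lambda>z. f (x(k := z))) \<partial>Pi\<^sub>M ?I M)"
  proof (rule sum_mono)
    fix k assume that: "k \<in> J"
    interpret k: prob_space "M k" by simp
    interpret pair_prob_space "M i" "M k" ..
    have ki: "k \<noteq> i" using that insert.hyps by auto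
    have kJ: "insert k J = J" using that by auto
    have mF: "(\<lambda>(x, z). F (x(k := z))) \<in> borel_measurable (Pi\<^sub>M J M \<Otimes>\<^sub>M M k)"
      by (intro measurable_comp_fun_upd) (simp add: kJ F)
    have meF: "(\<lambda>x. ent (M k) (\<lambda>z. F (x(k := z)))) \<in> borel_measurable (Pi\<^sub>M J M)"
      by (rule borel_measurable_ent[OF prob mF])
    have *: "ent (M k) (\<lambda>z. F (x(k := z))) \<le> (\<integral>y. ent (M k) (\<lambda>z. f (x(i := y, k := z))) \<partial>M i)"
      if x: "x \<in> space (Pi\<^sub>M J M)" for x
    proof -
      have "(\<lambda>(y, z). (x(k := z), y)) \<in> M i \<Otimes>\<^sub>M M k \<rightarrow>\<^sub>M Pi\<^sub>M J M \<Otimes>\<^sub>M M i"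
        using measurable_compose[OF _ measurable_add_dim, of "\<lambda>p. (x, snd p)" "M i \<Otimes>\<^sub>M M k" J M k] x
        by (simp add: kJ case_prod_beta')
      from measurable_compose[OF this m]
      have "(\<lambda>(y, z). f (x(i := y, k := z))) \<in> borel_measurable (M i \<Otimes>\<^sub>M M k)"
        using ki by (simp add: case_prod_beta' fun_upd_twist)
      then have "ent (M k) (\<lambda>z. \<integral>y. f (x(i := y, k := z)) \<partial>M i)
          \<le> (\<integral>y. ent (M k) (\<lambda>z. f (x(i := y, k := z))) \<partial>M i)"
      proof (rule ent_integral_le[OF _ \<open>0 < a\<close>])
        show "f (x(i := y, k := z)) \<in> {a..b}" if "y \<in> space (M i)" "z \<in> space (M k)" for y z
          using fi[OF fun_upd_in_space_PiM[OF x that(2) kJ] that(1)] ki by (simp add: fun_upd_twist)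
      qed
      then show ?thesis
        using ki by (simp add: F_def fun_upd_twist)
    qed
    have "(\<integral>x. ent (M k) (\<lambda>z. F (x(k := z))) \<partial>Pi\<^sub>M J M)
        \<le> (\<integral>x. (\<integral>y. ent (M k) (\<lambda>z. f (x(i := y, k := z))) \<partial>M i) \<partial>Pi\<^sub>M J M)"
    proof (rule integral_mono[OF _ _ *])
      show "integrable (Pi\<^sub>M J M) (\<lambda>x. ent (M k) (\<lambda>z. F (x(k := z))))"
        by (rule J.integrable_bounded[where C = "2 * ?c", OF meF],
            rule prob_space.abs_ent_le[OF prob _ \<open>0 < a\<close>])
          (use measurable_Pair2[OF mF] Fab[OF fun_upd_in_space_PiM[OF _ _ kJ]] in auto)
      have mm: "(\<lambda>(x, y). ent (M k) (\<lambda>z. f (x(i := y, k := z)))) \<in> borel_measurable (Pi\<^sub>M J M \<Otimes>\<^sub>M M i)"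
        using measurable_comp_fun_upd[OF me[of k]] \<open>k \<in> J\<close> by simp
      show "integrable (Pi\<^sub>M J M) (\<lambda>x. \<integral>y. ent (M k) (\<lambda>z. f (x(i := y, k := z))) \<partial>M i)"
        by (rule J.integrable_bounded[where C = "2 * ?c", OF M.borel_measurable_lebesgue_integral[OF mm]],
            rule i.abs_integral_le)
          (use measurable_Pair2[OF mm] \<open>k \<in> J\<close> fun_upd_in_space_PiM[of _ J M _ i ?I] in \<open>auto intro!: e\<close>)
    qed
    also have "\<dots> = (\<integral>x. ent (M k) (\<lambda>z. f (x(k := z))) \<partial>Pi\<^sub>M ?I M)"
      by (rule integral_insert[symmetric, OF insert.hyps me e]) (use that in auto)
    finally show "(\<integral>x. ent (M k) (\<lambda>z. F (x(k := z))) \<partial>Pi\<^sub>M J M)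
      \<le> (\<integral>x. ent (M k) (\<lambda>z. f (x(k := z))) \<partial>Pi\<^sub>M ?I M)" .
  qed
  ultimately show ?case
    unfolding sum.insert[OF insert.hyps] by linarith
qed

end

subsection \<open>Entropy inequality in one coordinate\<close>

text \<open>The constant \<open>B\<close> multiplying the variance in the coordinate inequality; it
  is \<open>t\<^sup>2 / 2\<close> to leading order.\<close>

definition ent_coeff :: "real \<Rightarrow> real"
  where "ent_coeff t = entropy_fn t + (exp t - 1) * (exp t - 1 - t)"

text \<open>The derivative of \<open>t * (exp t - 1) - 2 * (exp t - 1 - t)\<close> is
  \<open>entropy_fn t\<close>. This turns the a priori entropy bound into
  \<open>y \<le> t / 2\<close>.\<close>

lemma exp_diff_le_half:
  assumes "0 \<le> (t :: real)"
  shows "exp t - 1 - t \<le> t / 2 * (exp t - 1)"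
proof -
  have "0 \<le> t * (exp t - 1) - 2 * (exp t - 1 - t)"
    by (rule nonneg_if_deriv_nonneg[where t = t and F' = entropy_fn])
      (auto intro!: derivative_eq_intros entropy_fn_nonneg assms, auto simp: entropy_fn_def algebra_simps)
  then show ?thesis by (simp add: algebra_simps)
qed

lemma ent_coeff_nonneg:
  assumes "0 \<le> t" shows "0 \<le> ent_coeff t"
proof -
  have "0 \<le> exp t - 1 - t" using exp_ge_add_one_self[of t] by linarith
  then show ?thesis
    unfolding ent_coeff_def using assms entropy_fn_nonneg[OF assms]
    by (intro add_nonneg_nonneg mult_nonneg_nonneg) auto
qed

context prob_space
begin

lemma integral_exp_scaled_le:
  fixes s :: "'a \<Rightarrow> real"
  assumes [measurable]: "s \<in> borel_measurable M"
    and s: "\<And>x. x \<in> space M \<Longrightarrow> \<bar>s x\<bar> \<le> 1" and "(\<integral>x. s x \<partial>M) = 0" and "0 \<le> t"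
  shows "(\<integral>x. exp (- t * s x) \<partial>M) \<le> 1 + (\<integral>x. (s x)\<^sup>2 \<partial>M) * (exp t - 1 - t)"
proof -
  have s2: "(s x)\<^sup>2 \<le> 1" if "x \<in> space M" for x
    using s[OF that] by (simp add: abs_square_le_1)
  have ts: "- (t * s x) \<le> t" if "x \<in> space M" for x
    using mult_left_mono[of "- s x" 1 t] s[OF that] \<open>0 \<le> t\<close> by simp
  have [simp]: "integrable M s" "integrable M (\<lambda>x. (s x)\<^sup>2)"
    by (rule integrable_bounded[where C = 1]; use s s2 in simp)+
  have "(\<integral>x. exp (- t * s x) \<partial>M) \<le> (\<integral>x. 1 - t * s x + (s x)\<^sup>2 * (exp t - 1 - t) \<partial>M)"
  proof (rule integral_mono)
    show "integrable M (\<lambda>x. exp (- t * s x))"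
      by (rule integrable_bounded[where C = "exp t"]) (use ts in auto)
    show "exp (- t * s x) \<le> 1 - t * s x + (s x)\<^sup>2 * (exp t - 1 - t)" if "x \<in> space M" for x
      using exp_scaled_le[of "- s x" t] s[OF that] \<open>0 \<le> t\<close> by simp
  qed simp
  also have "\<dots> = 1 + (\<integral>x. (s x)\<^sup>2 \<partial>M) * (exp t - 1 - t)"
    by (simp add: assms prob_space)
  finally show ?thesis .
qed

lemma ent_exp_sup_le:
  fixes c :: "'i \<Rightarrow> real" and s :: "'i \<Rightarrow> 'a \<Rightarrow> real" and t :: real and I :: "'i set"
  defines "Z \<equiv> \<lambda>y. SUP i\<in>I. c i + s i y"
  defines "m \<equiv> \<integral>y. exp (- t * Z y) \<partial>M" and "\<phi> \<equiv> exp t - 1"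
  assumes "0 < t" and "I \<noteq> {}" and bdd: "bdd_above (c ` I)"
    and s_meas: "\<And>i. i \<in> I \<Longrightarrow> s i \<in> borel_measurable M"
    and s_le: "\<And>i y. i \<in> I \<Longrightarrow> y \<in> space M \<Longrightarrow> \<bar>s i y\<bar> \<le> 1"
    and s_0: "\<And>i. i \<in> I \<Longrightarrow> (\<integral>y. s i y \<partial>M) = 0"
    and Z[measurable]: "Z \<in> borel_measurable M"
    and "i \<in> I"
  shows "ent M (\<lambda>y. exp (- t * Z y)) / ((1 + t / 2) * \<phi> * m)
    \<le> - ln m - t * c i + (\<integral>y. (s i y)\<^sup>2 \<partial>M) * ent_coeff t / \<phi>"
proof -
  define f where "f y = exp (- t * Z y)" for y
  \<comment> \<open>A deterministic centre: \<open>Z\<close> stays within 1 of \<open>cs\<close>,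
    which bounds \<open>f\<close> away from 0 and infinity.\<close>
  define cs where "cs = (SUP i\<in>I. c i)"
  let ?K = "exp t - 1 - t" and ?B = "ent_coeff t" and ?v = "\<integral>y. (s i y)\<^sup>2 \<partial>M"
  let ?H = "ent M f"
  have K: "0 \<le> ?K" using exp_ge_add_one_self[of t] by linarith
  have \<phi>: "0 < \<phi>" using \<open>0 < t\<close> by (simp add: \<phi>_def)
  have B: "0 \<le> ?B" using ent_coeff_nonneg \<open>0 < t\<close> by simp
  have c_le: "c j \<le> cs" if "j \<in> I" for j
    unfolding cs_def by (rule cSUP_upper[OF that bdd])
  have bddZ: "bdd_above ((\<lambda>i. c i + s i y) ` I)" if "y \<in> space M" for y
    by (rule bdd_aboveI[of _ "cs + 1"]) (use c_le s_le[OF _ that] in \<open>force simp: abs_le_iff\<close>)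
  have Z_ge: "c j + s j y \<le> Z y" if "j \<in> I" "y \<in> space M" for j y
    unfolding Z_def by (rule cSUP_upper[OF that(1) bddZ[OF that(2)]])
  have Z_bd: "\<bar>Z y - cs\<bar> \<le> 1" if y: "y \<in> space M" for y
  proof -
    have "Z y \<le> cs + 1"
      unfolding Z_def by (rule cSUP_least[OF \<open>I \<noteq> {}\<close>]) (use c_le s_le[OF _ y] in \<open>force simp: abs_le_iff\<close>)
    moreover have "cs \<le> Z y + 1"
      unfolding cs_def by (rule cSUP_least[OF \<open>I \<noteq> {}\<close>]) (use Z_ge[OF _ y] s_le[OF _ y] in \<open>force simp: abs_le_iff\<close>)
    ultimately show ?thesis by linarith
  qed
  have [measurable]: "f \<in> borel_measurable M" unfolding f_def by measurable
  have [measurable]: "s i \<in> borel_measurable M" using s_meas \<open>i \<in> I\<close> by simp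
  have si: "\<bar>s i y\<bar> \<le> 1" if "y \<in> space M" for y using s_le \<open>i \<in> I\<close> that by simp
  have si2: "(s i y)\<^sup>2 \<le> 1" if "y \<in> space M" for y
    using si[OF that] by (simp add: abs_square_le_1)
  define a b where "a = exp (- t * (cs + 1))" and "b = exp (- t * (cs - 1))"
  have ab: "0 < a" "f y \<in> {a..b}" if "y \<in> space M" for y
    using Z_bd[OF that] \<open>0 < t\<close> by (auto simp: a_def b_def f_def)
  have m_f: "m = (\<integral>y. f y \<partial>M)" by (simp add: m_def f_def)
  have "0 < a" by (simp add: a_def)
  have m: "0 < m"
    using integral_between(1)[of f a b] ab \<open>0 < a\<close> by (auto simp: m_f)
  have int_f[simp]: "integrable M f"
    by (rule integrable_bounded[where C = b]) (use ab \<open>0 < a\<close> in force)+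
  have int_flnf[simp]: "integrable M (\<lambda>y. f y * ln (f y))"
    by (rule integrable_mult_ln[where a = a and b = b]) (use ab \<open>0 < a\<close> in auto)
  have [simp]: "integrable M (s i)" "integrable M (\<lambda>y. (s i y)\<^sup>2)"
    by (rule integrable_bounded[where C = 1]; use si si2 in simp)+
  have v: "?v \<le> 1"
    using integral_between(2)[of "\<lambda>y. (s i y)\<^sup>2" 0 1] si2 by simp
  have ent: "?H = (\<integral>y. f y * (ln (f y) - ln m) \<partial>M)"
    by (simp add: ent_def m_f right_diff_distrib)
  have H0: "0 \<le> ?H" by (rule ent_nonneg[of f a b]) (use ab \<open>0 < a\<close> in auto)

  \<comment> \<open>Integrate \<open>f \<le> exp (- t * (c j + s j))\<close> and bound the second
    moment of \<open>s j\<close> by 1.\<close>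
  have tc: "t * c j \<le> - ln m + ?K" if "j \<in> I" for j
  proof -
    have [measurable]: "s j \<in> borel_measurable M" using s_meas that by simp
    have int: "integrable M (\<lambda>y. exp (- t * s j y))"
      by (rule integrable_bounded[where C = "exp t"])
        (use s_le[OF that] \<open>0 < t\<close> mult_left_mono[of "- s j _" 1 t] in \<open>force simp: abs_le_iff\<close>)+
    have "m \<le> (\<integral>y. exp (- t * c j) * exp (- t * s j y) \<partial>M)"
      unfolding m_f
    proof (rule integral_mono)
      show "f y \<le> exp (- t * c j) * exp (- t * s j y)" if "y \<in> space M" for y
        using Z_ge[OF \<open>j \<in> I\<close> that] \<open>0 < t\<close> mult_left_mono[of "c j + s j y" "Z y" t]
        by (simp add: f_def exp_add[symmetric] algebra_simps)
    qed (use int in simp_all)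
    also have "\<dots> = exp (- t * c j) * (\<integral>y. exp (- t * s j y) \<partial>M)" by simp
    also have "(\<integral>y. exp (- t * s j y) \<partial>M) \<le> exp ?K"
    proof -
      have "(s j y)\<^sup>2 \<le> 1" if "y \<in> space M" for y
        using s_le[OF \<open>j \<in> I\<close> that] by (simp add: abs_square_le_1)
      then have "(\<integral>y. (s j y)\<^sup>2 \<partial>M) \<le> 1"
        using integral_between(2)[of "\<lambda>y. (s j y)\<^sup>2" 0 1] by simp
      then have "1 + (\<integral>y. (s j y)\<^sup>2 \<partial>M) * ?K \<le> 1 + ?K"
        using mult_right_mono[OF _ K] by fastforce
      also have "\<dots> \<le> exp ?K" by (rule exp_ge_add_one_self)
      finally show ?thesis
        using integral_exp_scaled_le[of "s j" t] s_le s_0 that \<open>0 < t\<close> by fastforce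
    qed
    finally have "m \<le> exp (- t * c j + ?K)" by (simp only: exp_add) simp
    then have "ln m \<le> - t * c j + ?K" using m by (metis ln_exp ln_le_cancel_iff exp_gt_zero)
    then show ?thesis by simp
  qed
  \<comment> \<open>Adding \<open>t * s j y \<le> t\<close> to \<open>tc\<close> turns
    \<open>?K\<close> into \<open>?K + t = \<phi>\<close>; the supremum over \<open>j\<close> then
    bounds \<open>t * Z y\<close>, which is \<open>- ln (f y)\<close>.\<close>
  have phi_bd: "ln m - ln (f y) \<le> \<phi>" if y: "y \<in> space M" for y
  proof -
    have "Z y \<le> (- ln m + \<phi>) / t"
      unfolding Z_def
    proof (rule cSUP_least[OF \<open>I \<noteq> {}\<close>])
      fix j assume j: "j \<in> I"
      have "t * s j y \<le> t" using mult_left_mono[of "s j y" 1 t] s_le[OF j y] \<open>0 < t\<close> by simp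
      then have "t * (c j + s j y) \<le> - ln m + \<phi>"
        using tc[OF j] by (simp add: \<phi>_def algebra_simps)
      then show "c j + s j y \<le> (- ln m + \<phi>) / t" using \<open>0 < t\<close> by (simp add: field_simps)
    qed
    then show ?thesis using \<open>0 < t\<close> by (simp add: f_def field_simps)
  qed

  \<comment> \<open>\<open>ln z \<le> z - 1\<close> with \<open>z = (f y / m) * exp (t * s i y)\<close>, and \<open>phi_bd\<close> multiplied by
    the nonnegative difference of the comparison function and \<open>f\<close>\<close>
  have main: "?H + \<phi> * m \<le> exp (- t * c i) * (\<phi> + ?v * ?B)"
  proof -
    let ?a = "exp (- t * c i)"
    have "f y * (ln (f y) - ln m)
        \<le> ?a / m * f y - \<phi> * f y + ?a * (\<phi> - 1) - ?a * \<phi> * t * s i y + ?a * ?B * (s i y)\<^sup>2"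
      if y: "y \<in> space M" for y
    proof -
      let ?L = "ln (f y) - ln m" and ?e = "exp (- t * s i y)"
      have f0: "0 < f y" by (simp add: f_def)
      have "f y \<le> ?a * ?e"
        using Z_ge[OF \<open>i \<in> I\<close> y] \<open>0 < t\<close> mult_left_mono[of "c i + s i y" "Z y" t]
        by (simp add: f_def exp_add[symmetric] algebra_simps)
      then have "0 \<le> (?a * ?e - f y) * (\<phi> + ?L)"
        using phi_bd[OF y] by (intro mult_nonneg_nonneg) auto
      moreover have "?a * ?e * (?L + t * s i y) \<le> ?a * ?e * (exp (?L + t * s i y) - 1)"
      proof (rule mult_left_mono)
        show "?L + t * s i y \<le> exp (?L + t * s i y) - 1"
          using exp_ge_add_one_self[of "?L + t * s i y"] by linarith
      qed simp
      moreover have "?a * ?e * exp (?L + t * s i y) = ?a / m * f y"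
        using f0 m by (simp add: exp_add exp_diff exp_minus)
      \<comment> \<open>The part \<open>(- 1 - t * s i y) * ?e\<close> equals
        \<open>entropy_fn (- t * s i y) - 1\<close>. Bounding it and \<open>\<phi> * ?e\<close>
        separately produces the two summands of \<open>ent_coeff\<close>.\<close>
      moreover have "?a * ((\<phi> - 1 - t * s i y) * ?e)
          \<le> ?a * (\<phi> - 1 - \<phi> * t * s i y + (s i y)\<^sup>2 * ?B)"
      proof (rule mult_left_mono)
        have s': "\<bar>- s i y\<bar> \<le> 1" using si[OF y] by simp
        have "entropy_fn (t * - s i y) \<le> (s i y)\<^sup>2 * entropy_fn t"
          using entropy_fn_scaled_le[OF s', of t] \<open>0 < t\<close> by simp
        moreover have "\<phi> * ?e \<le> \<phi> * (1 - t * s i y + (s i y)\<^sup>2 * ?K)"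
          using exp_scaled_le[OF s', of t] \<open>0 < t\<close> \<phi> by (intro mult_left_mono) auto
        ultimately show "(\<phi> - 1 - t * s i y) * ?e \<le> \<phi> - 1 - \<phi> * t * s i y + (s i y)\<^sup>2 * ?B"
          by (simp add: entropy_fn_def ent_coeff_def \<phi>_def[symmetric] algebra_simps)
      qed simp
      ultimately show ?thesis by (simp add: algebra_simps)
    qed
    then have "?H \<le> (\<integral>y. ?a / m * f y - \<phi> * f y + ?a * (\<phi> - 1) - ?a * \<phi> * t * s i y
        + ?a * ?B * (s i y)\<^sup>2 \<partial>M)"
      unfolding ent by (intro integral_mono) (auto simp: right_diff_distrib)
    also have "\<dots> = ?a / m * m - \<phi> * m + ?a * (\<phi> - 1) + ?a * ?B * ?v"
      by (simp add: m_f[symmetric] prob_space s_0 \<open>i \<in> I\<close>)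
    finally show ?thesis using m by (simp add: algebra_simps)
  qed

  \<comment> \<open>An a priori bound of second order in \<open>t\<close>: it makes \<open>y\<close> below small, so that \<open>ln (1 + y)\<close> can be
    bounded from below by a multiple of \<open>y\<close>.\<close>
  have HK: "?H \<le> m * ?K"
  proof -
    let ?a = "exp (- t * cs)"
    \<comment> \<open>Since \<open>f y * exp (t * (Z y - cs))\<close> is the constant
      \<open>?a\<close>, an upper bound on this exponential is an upper bound on
      \<open>f y * ln (f y)\<close>.\<close>
    have "f y * ln (f y) \<le> f y * (?K + 1 - t * cs) - ?a" if y: "y \<in> space M" for y
    proof -
      let ?s = "Z y - cs"
      have "exp (t * ?s) \<le> 1 + t * ?s + ?s\<^sup>2 * ?K"
        by (rule exp_scaled_le) (use Z_bd[OF y] \<open>0 < t\<close> in auto)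
      also have "?s\<^sup>2 * ?K \<le> 1 * ?K"
        using Z_bd[OF y] K by (intro mult_right_mono) (auto simp: abs_square_le_1)
      finally have "f y * exp (t * ?s) \<le> f y * (1 + t * ?s + ?K)"
        by (intro mult_left_mono) (auto simp: f_def)
      moreover have "f y * exp (t * ?s) = ?a"
        by (simp add: f_def exp_add[symmetric] algebra_simps)
      ultimately show ?thesis by (simp add: f_def algebra_simps)
    qed
    then have "(\<integral>y. f y * ln (f y) \<partial>M) \<le> (\<integral>y. f y * (?K + 1 - t * cs) - ?a \<partial>M)"
      by (intro integral_mono) auto
    also have "\<dots> = m * (?K + 1 - t * cs) - ?a" by (simp add: m_f[symmetric] prob_space)
    finally have "?H \<le> m * (?K + 1 - t * cs) - ?a - m * ln m"
      by (simp add: ent_def m_f[symmetric])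
    \<comment> \<open>The unknown \<open>?a\<close> is eliminated by \<open>ln z \<le> z - 1\<close>
      at \<open>z = ?a / m\<close>.\<close>
    moreover have "m * ln (?a / m) \<le> m * (?a / m - 1)"
      using m by (intro mult_left_mono ln_le_minus_one) auto
    moreover have "m * ln (?a / m) = - m * t * cs - m * ln m"
      using m by (simp add: ln_div algebra_simps)
    moreover have "m * (?a / m - 1) = ?a - m" using m by (simp add: field_simps)
    ultimately show ?thesis by (simp add: algebra_simps)
  qed

  \<comment> \<open>The normalization makes \<open>1 + y = (?H + \<phi> * m) / (m * \<phi>)\<close>,
    the left-hand side of \<open>main\<close> up to scaling. Below,
    \<open>ln (1 + y) \<ge> y / (1 + y)\<close> is combined with
    \<open>y \<le> t / 2\<close>.\<close>
  define y where "y = ?H / (m * \<phi>)"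
  have y0: "0 \<le> y" using H0 m \<phi> by (simp add: y_def)
  have "?H \<le> m * (t / 2 * \<phi>)"
    using HK exp_diff_le_half[of t] \<open>0 < t\<close> m unfolding \<phi>_def
    by (meson less_imp_le mult_left_mono order_trans)
  then have y_le: "y \<le> t / 2" using m \<phi> by (simp add: y_def field_simps)
  have "y / (1 + t / 2) \<le> y / (1 + y)"
    using y0 y_le by (intro divide_left_mono mult_pos_pos) auto
  also have "\<dots> = 1 - 1 / (1 + y)" using y0 by (simp add: field_simps)
  also have "\<dots> \<le> - ln (1 / (1 + y))"
    using ln_le_minus_one[of "1 / (1 + y)"] y0 by auto
  also have "\<dots> = ln (1 + y)" using y0 by (simp add: ln_div)
  also have "\<dots> \<le> ln (exp (- t * c i) / m * (1 + ?v * ?B / \<phi>))"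
  proof -
    have "1 + y \<le> exp (- t * c i) / m * (1 + ?v * ?B / \<phi>)"
    proof -
      have "1 + y = (?H + \<phi> * m) / (m * \<phi>)" using m \<phi> by (simp add: y_def add_divide_distrib)
      also have "\<dots> \<le> exp (- t * c i) * (\<phi> + ?v * ?B) / (m * \<phi>)"
        using main m \<phi> by (intro divide_right_mono) auto
      also have "\<dots> = exp (- t * c i) / m * (1 + ?v * ?B / \<phi>)" using m \<phi> by (simp add: field_simps)
      finally show ?thesis .
    qed
    then show ?thesis using y0 by (intro ln_mono) auto
  qed
  also have "\<dots> = - t * c i - ln m + ln (1 + ?v * ?B / \<phi>)"
  proof -
    have "0 \<le> ?v * ?B / \<phi>" using B \<phi> by simp
    then have "0 < 1 + ?v * ?B / \<phi>" by linarith
    then show ?thesis using m by (simp add: ln_mult ln_div)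
  qed
  also have "ln (1 + ?v * ?B / \<phi>) \<le> ?v * ?B / \<phi>"
    using B \<phi> by (intro ln_add_one_self_le_self) simp
  finally have "y / (1 + t / 2) \<le> - t * c i - ln m + ?v * ?B / \<phi>" by simp
  moreover have "(\<lambda>y. exp (- t * Z y)) = f" by (simp add: f_def fun_eq_iff)
  ultimately show ?thesis by (simp add: y_def mult_ac)
qed

end

subsection \<open>Entropy inequality on the product space\<close>

text \<open>The canonical model, with independent coordinates on a product space. By centering, the
  second moments are variances; \<open>V\<close> is any bound on their sums, so that the locale can
  be instantiated before the supremum of the variances has been identified.\<close>

locale centered_class = finite_product_prob M for M :: "'i \<Rightarrow> 'a measure" +
  fixes I :: "'i set" and \<S> :: "('i \<Rightarrow> 'a \<Rightarrow> real) set" and V :: real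
  assumes finite_I: "finite I" and I_ne: "I \<noteq> {}"
    and S_ne: "\<S> \<noteq> {}" and countable_S: "countable \<S>"
    and S_meas: "\<And>s k. s \<in> \<S> \<Longrightarrow> k \<in> I \<Longrightarrow> s k \<in> borel_measurable (M k)"
    and S_le: "\<And>s k y. s \<in> \<S> \<Longrightarrow> k \<in> I \<Longrightarrow> y \<in> space (M k) \<Longrightarrow> \<bar>s k y\<bar> \<le> 1"
    and S_0: "\<And>s k. s \<in> \<S> \<Longrightarrow> k \<in> I \<Longrightarrow> (\<integral>y. s k y \<partial>M k) = 0"
    and V: "\<And>s. s \<in> \<S> \<Longrightarrow> (\<Sum>k\<in>I. \<integral>y. (s k y)\<^sup>2 \<partial>M k) \<le> V"
begin

abbreviation P :: "('i \<Rightarrow> 'a) measure" where "P \<equiv> Pi\<^sub>M I M"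

definition part_sum :: "('i \<Rightarrow> 'a \<Rightarrow> real) \<Rightarrow> ('i \<Rightarrow> 'a) \<Rightarrow> real"
  where "part_sum s x = (\<Sum>k\<in>I. s k (x k))"

definition Z :: "('i \<Rightarrow> 'a) \<Rightarrow> real"
  where "Z x = (SUP s\<in>\<S>. part_sum s x)"

sublocale P: prob_space P by simp

lemma part_sum_measurable:
  assumes "s \<in> \<S>" shows "part_sum s \<in> borel_measurable P"
  unfolding part_sum_def
proof (rule borel_measurable_sum)
  show "(\<lambda>x. s k (x k)) \<in> borel_measurable P" if "k \<in> I" for k
    using measurable_component_singleton[OF that] S_meas[OF assms that] by (rule measurable_compose)
qed

lemma abs_part_sum_le:
  assumes "s \<in> \<S>" "x \<in> space P" shows "\<bar>part_sum s x\<bar> \<le> card I"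
proof -
  have "\<bar>part_sum s x\<bar> \<le> (\<Sum>k\<in>I. \<bar>s k (x k)\<bar>)" unfolding part_sum_def by (rule sum_abs)
  also have "\<dots> \<le> (\<Sum>k\<in>I. 1)"
    using assms by (intro sum_mono S_le) (auto simp: space_PiM)
  finally show ?thesis by simp
qed

lemma bdd_above_part_sum: "x \<in> space P \<Longrightarrow> bdd_above ((\<lambda>s. part_sum s x) ` \<S>)"
  using abs_part_sum_le by (intro bdd_aboveI[of _ "real (card I)"]) (auto simp: abs_le_iff)

lemma part_sum_le_Z: "s \<in> \<S> \<Longrightarrow> x \<in> space P \<Longrightarrow> part_sum s x \<le> Z x"
  unfolding Z_def by (intro cSUP_upper bdd_above_part_sum)

lemma Z_measurable[measurable]: "Z \<in> borel_measurable P"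
  unfolding Z_def
  by (intro borel_measurable_cSUP countable_S part_sum_measurable bdd_above_part_sum)

lemma abs_Z_le:
  assumes "x \<in> space P" shows "\<bar>Z x\<bar> \<le> card I"
proof -
  obtain s where s: "s \<in> \<S>" using S_ne by blast
  have "Z x \<le> card I"
    unfolding Z_def by (rule cSUP_least[OF S_ne]) (use abs_part_sum_le[OF _ assms] in \<open>force simp: abs_le_iff\<close>)
  then show ?thesis
    using part_sum_le_Z[OF s assms] abs_part_sum_le[OF s assms] by linarith
qed

lemma part_sum_upd:
  assumes "k \<in> I"
  shows "part_sum s (x(k := y)) = part_sum s x - s k (x k) + s k y"
proof -
  have "part_sum s (x(k := y)) = s k y + (\<Sum>j\<in>I - {k}. s j ((x(k := y)) j))"
    unfolding part_sum_def by (subst sum.remove[OF finite_I assms]) simp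
  also have "(\<Sum>j\<in>I - {k}. s j ((x(k := y)) j)) = (\<Sum>j\<in>I - {k}. s j (x j))"
    by (intro sum.cong) auto
  also have "\<dots> = part_sum s x - s k (x k)"
    unfolding part_sum_def by (subst sum.remove[OF finite_I assms, of "\<lambda>j. s j (x j)"]) simp
  finally show ?thesis by (simp del: fun_upd_apply)
qed

lemma V_nonneg: "0 \<le> V"
proof -
  obtain s where "s \<in> \<S>" using S_ne by blast
  then show ?thesis
    using order_trans[OF sum_nonneg V, of s] by (simp add: integral_nonneg_AE)
qed

text \<open>For one \<open>s\<close>, the terms \<open>- t * (part_sum s x - s k (x k))\<close> of
  the coordinate inequalities add up to \<open>- (n - 1) * t * part_sum s x\<close> with
  \<open>n = card I\<close>. The supremum over \<open>s\<close> replaces \<open>part_sum s x\<close>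
  by \<open>Z x\<close>, and the \<open>n\<close> terms \<open>- ln (f x) = t * Z x\<close> leave
  exactly one \<open>t * Z x\<close>.\<close>

lemma sum_coordinate_ent_le:
  fixes t :: real
  defines "f \<equiv> \<lambda>x. exp (- t * Z x)" and "\<phi> \<equiv> exp t - 1"
  defines "m \<equiv> \<lambda>k x. \<integral>y. f (x(k := y)) \<partial>M k" and "H \<equiv> \<lambda>k x. ent (M k) (\<lambda>y. f (x(k := y)))"
  assumes "0 < t" and x: "x \<in> space P"
  shows "(\<Sum>k\<in>I. H k x / ((1 + t / 2) * \<phi> * m k x) + (ln (m k x) - ln (f x)))
    \<le> t * Z x + ent_coeff t * V / \<phi>"
proof -
  let ?L = "\<Sum>k\<in>I. H k x / ((1 + t / 2) * \<phi> * m k x) + ln (m k x)"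
  let ?n = "real (card I)" and ?B = "ent_coeff t"
  have B: "0 \<le> ?B / \<phi>" using \<open>0 < t\<close> ent_coeff_nonneg[of t] by (simp add: \<phi>_def)
  have n: "1 \<le> ?n" using I_ne finite_I by (simp add: Suc_le_eq card_gt_0_iff)
  have k: "H k x / ((1 + t / 2) * \<phi> * m k x) + ln (m k x)
      \<le> - t * part_sum s x + t * s k (x k) + (\<integral>y. (s k y)\<^sup>2 \<partial>M k) * (?B / \<phi>)"
    if "k \<in> I" "s \<in> \<S>" for k s
  proof -
    interpret k: prob_space "M k" by simp
    have xk: "x k \<in> space (M k)" using x that by (auto simp: space_PiM)
    have bdd: "bdd_above ((\<lambda>s. part_sum s x - s k (x k)) ` \<S>)"
    proof (rule bdd_aboveI2[where M = "?n + 1"])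
      show "part_sum s x - s k (x k) \<le> ?n + 1" if "s \<in> \<S>" for s
        using abs_part_sum_le[OF that x] S_le[OF that \<open>k \<in> I\<close> xk] by linarith
    qed
    \<comment> \<open>As a function of coordinate \<open>k\<close> alone, \<open>Z\<close> is a
      supremum of the form in \<open>ent_exp_sup_le\<close>, with frozen part
      \<open>part_sum s x - s k (x k)\<close>.\<close>
    have Zk: "Z (x(k := y)) = (SUP s\<in>\<S>. part_sum s x - s k (x k) + s k y)" for y
      using that by (simp add: Z_def part_sum_upd)
    have "(\<lambda>(x, y). Z (x(k := y))) \<in> borel_measurable (P \<Otimes>\<^sub>M M k)"
      by (rule measurable_comp_fun_upd) (use that in \<open>simp add: insert_absorb\<close>)
    from measurable_Pair2[OF this x]
    have meas: "(\<lambda>y. SUP s\<in>\<S>. part_sum s x - s k (x k) + s k y) \<in> borel_measurable (M k)"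
      by (simp add: Zk)
    have "H k x / ((1 + t / 2) * \<phi> * m k x)
        \<le> - ln (m k x) - t * (part_sum s x - s k (x k)) + (\<integral>y. (s k y)\<^sup>2 \<partial>M k) * ?B / \<phi>"
      unfolding H_def m_def f_def \<phi>_def Zk
      by (rule k.ent_exp_sup_le[where s = "\<lambda>s. s k", OF \<open>0 < t\<close> S_ne bdd])
        (use S_meas S_le S_0 that meas in blast)+
    then show ?thesis by (simp add: algebra_simps)
  qed
  have R: "(?n - 1) * t * part_sum s x \<le> ?B * V / \<phi> - ?L" if "s \<in> \<S>" for s
  proof -
    have "?L \<le> (\<Sum>k\<in>I. - t * part_sum s x + t * s k (x k) + (\<integral>y. (s k y)\<^sup>2 \<partial>M k) * (?B / \<phi>))"
      by (rule sum_mono[OF k[OF _ that]])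
    also have "\<dots> = - ?n * t * part_sum s x + t * part_sum s x
        + (\<Sum>k\<in>I. \<integral>y. (s k y)\<^sup>2 \<partial>M k) * (?B / \<phi>)"
      by (simp add: sum.distrib part_sum_def sum_distrib_left sum_distrib_right sum_negf sum_subtractf
          sum_divide_distrib mult.assoc)
    also have "(\<Sum>k\<in>I. \<integral>y. (s k y)\<^sup>2 \<partial>M k) * (?B / \<phi>) \<le> V * (?B / \<phi>)"
      by (rule mult_right_mono[OF V[OF that] B])
    finally show ?thesis by (simp add: algebra_simps)
  qed
  \<comment> \<open>If \<open>?n = 1\<close> the factor is 0 and any \<open>s\<close> will do;
    otherwise division by the positive factor gives an upper bound for all partial sums, hence for
    \<open>Z x\<close>.\<close>
  have "(?n - 1) * t * Z x \<le> ?B * V / \<phi> - ?L"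
  proof (cases "?n = 1")
    case True
    then show ?thesis using R S_ne by auto
  next
    case False
    then have pos: "0 < (?n - 1) * t" using n \<open>0 < t\<close> by simp
    have "Z x \<le> (?B * V / \<phi> - ?L) / ((?n - 1) * t)"
      unfolding Z_def
      by (rule cSUP_least[OF S_ne], subst pos_le_divide_eq[OF pos]) (use R in \<open>simp add: mult_ac\<close>)
    then have "Z x * ((?n - 1) * t) \<le> ?B * V / \<phi> - ?L"
      by (simp only: pos_le_divide_eq[OF pos])
    then show ?thesis by (simp only: mult.commute)
  qed
  moreover have "(\<Sum>k\<in>I. H k x / ((1 + t / 2) * \<phi> * m k x) + (ln (m k x) - ln (f x))) = ?L + ?n * t * Z x"
    by (simp add: sum.distrib sum_subtractf f_def)
  ultimately show ?thesis by (simp add: algebra_simps)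
qed

text \<open>Multiply the pointwise inequality by \<open>f\<close> and integrate. Both
  \<open>f * H k / m k\<close> and \<open>f * (ln f - ln (m k))\<close> have the expectation of
  \<open>H k\<close>, so the left-hand side becomes \<open>1 / \<kappa> - 1\<close> times the sum
  that tensorization bounds from below.\<close>

lemma ent_exp_Z_le:
  fixes t :: real
  defines "f \<equiv> \<lambda>x. exp (- t * Z x)" and "\<kappa> \<equiv> (1 + t / 2) * (exp t - 1)"
  assumes "0 < t" and "\<kappa> \<le> 1"
  shows "(1 - \<kappa>) * ent P f
    \<le> \<kappa> * t * (\<integral>x. Z x * f x \<partial>P) + (1 + t / 2) * ent_coeff t * V * (\<integral>x. f x \<partial>P)"
proof -
  define \<phi> where "\<phi> = exp t - 1"
  define m where "m k x = (\<integral>y. f (x(k := y)) \<partial>M k)" for k x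
  define H where "H k x = ent (M k) (\<lambda>y. f (x(k := y)))" for k x
  define a b where "a = exp (- (t * card I))" and "b = exp (t * card I)"
  define C where "C = 2 * (b * (\<bar>ln a\<bar> + \<bar>ln b\<bar>))"
  have \<phi>: "0 < \<phi>" using \<open>0 < t\<close> by (simp add: \<phi>_def)
  have \<kappa>: "\<kappa> = (1 + t / 2) * \<phi>" "0 < \<kappa>" using \<open>0 < t\<close> \<phi> by (simp_all add: \<kappa>_def \<phi>_def)
  have a: "0 < a" by (simp add: a_def)
  have f[measurable]: "f \<in> borel_measurable P" unfolding f_def by measurable
  have fab: "f x \<in> {a..b}" if "x \<in> space P" for x
    using abs_Z_le[OF that] mult_left_mono[of "Z x" "card I" t] mult_left_mono[of "- Z x" "card I" t] \<open>0 < t\<close>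
    by (auto simp: f_def a_def b_def abs_le_iff)
  have upd: "x(k := y) \<in> space P" if "k \<in> I" "x \<in> space P" "y \<in> space (M k)" for k x y
    using fun_upd_in_space_PiM[OF that(2,3)] that(1) by (auto simp: insert_absorb)
  have mk: "(\<lambda>(x, y). f (x(k := y))) \<in> borel_measurable (P \<Otimes>\<^sub>M M k)" if "k \<in> I" for k
    by (rule measurable_comp_fun_upd) (use that f in \<open>simp add: insert_absorb\<close>)
  have m_meas[measurable]: "m k \<in> borel_measurable P" if "k \<in> I" for k
    unfolding m_def by (rule M.borel_measurable_lebesgue_integral[OF mk[OF that]])
  have H_meas[measurable]: "H k \<in> borel_measurable P" if "k \<in> I" for k
    unfolding H_def by (rule borel_measurable_ent[OF prob mk[OF that]])
  have mab: "m k x \<in> {a..b}" if "k \<in> I" "x \<in> space P" for k x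
    using prob_space.integral_between[OF prob measurable_Pair2[OF mk[OF that(1)] that(2)], of a b]
      fab[OF upd[OF that]] by (auto simp: m_def)
  have H_le: "\<bar>H k x\<bar> \<le> C" if "k \<in> I" "x \<in> space P" for k x
    unfolding H_def C_def
    by (rule prob_space.abs_ent_le[OF prob measurable_Pair2[OF mk[OF that(1)] that(2)] a, simplified])
      (use fab[OF upd[OF that]] in auto)
  have b1: "1 \<le> b" using \<open>0 < t\<close> by (simp add: b_def)
  have C0: "0 \<le> C" using b1 by (simp add: C_def)
  have fH_le: "\<bar>f x * (H k x / m k x)\<bar> \<le> b * (C / a)" if "k \<in> I" "x \<in> space P" for k x
    unfolding abs_mult abs_divide using fab[OF that(2)] mab[OF that] H_le[OF that] a C0
    by (intro mult_mono frac_le) auto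
  have flnm_le: "\<bar>f x * ln (m k x)\<bar> \<le> C" "\<bar>f x * ln (f x)\<bar> \<le> C" if "k \<in> I" "x \<in> space P" for k x
    using abs_mult_ln_le[OF a, of "f x" b "m k x"] abs_mult_ln_le[OF a, of "f x" b "f x"]
      fab[OF that(2)] mab[OF that] b1 by (auto simp: C_def)
  \<comment> \<open>\<open>m k\<close> and \<open>H k\<close> ignore coordinate \<open>k\<close>, so
    resampling that coordinate integrates \<open>f\<close> alone and turns it into
    \<open>m k\<close>.\<close>
  have m_upd: "m k (x(k := y)) = m k x" "H k (x(k := y)) = H k x" for k x y
    by (simp_all add: m_def H_def)
  have int_H: "integrable P (H k)" if "k \<in> I" for k
    by (rule P.integrable_bounded[OF H_meas[OF that] H_le[OF that]])
  have intA: "integrable P (\<lambda>x. f x * (H k x / m k x))" if "k \<in> I" for k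
    by (rule P.integrable_bounded[OF _ fH_le[OF that]]) (use that in measurable)
  have intB: "integrable P (\<lambda>x. f x * ln (m k x))" "integrable P (\<lambda>x. f x * ln (f x))" if "k \<in> I" for k
    using that flnm_le[OF that] by (auto intro!: P.integrable_bounded)
  have A: "(\<integral>x. f x * (H k x / m k x) \<partial>P) = (\<integral>x. H k x \<partial>P)" if "k \<in> I" for k
  proof -
    have "(\<integral>x. f x * (H k x / m k x) \<partial>P)
        = (\<integral>x. (\<integral>y. f (x(k := y)) * (H k (x(k := y)) / m k (x(k := y))) \<partial>M k) \<partial>P)"
      by (rule integral_resample[OF finite_I that _ fH_le[OF that]]) (use that in measurable)
    also have "\<dots> = (\<integral>x. m k x * (H k x / m k x) \<partial>P)"
      by (simp only: m_upd integral_mult_left_zero m_def[symmetric])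
    also have "\<dots> = (\<integral>x. H k x \<partial>P)"
      by (rule Bochner_Integration.integral_cong) (use mab[OF that] a in force)+
    finally show ?thesis .
  qed
  have Bk: "(\<integral>x. f x * ln (f x) - f x * ln (m k x) \<partial>P) = (\<integral>x. H k x \<partial>P)" if "k \<in> I" for k
  proof -
    have 1: "(\<integral>x. f x * ln (f x) \<partial>P) = (\<integral>x. (\<integral>y. f (x(k := y)) * ln (f (x(k := y))) \<partial>M k) \<partial>P)"
      by (rule integral_resample[OF finite_I that _ flnm_le(2)[OF that]]) measurable
    have "(\<integral>x. f x * ln (m k x) \<partial>P)
        = (\<integral>x. (\<integral>y. f (x(k := y)) * ln (m k (x(k := y))) \<partial>M k) \<partial>P)"
      by (rule integral_resample[OF finite_I that _ flnm_le(1)[OF that]]) (use that in measurable)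
    also have "\<dots> = (\<integral>x. m k x * ln (m k x) \<partial>P)"
      by (simp only: m_upd integral_mult_left_zero m_def[symmetric])
    finally have 2: "(\<integral>x. f x * ln (m k x) \<partial>P) = (\<integral>x. m k x * ln (m k x) \<partial>P)" .
    have 3: "integrable P (\<lambda>x. m k x * ln (m k x))"
      by (rule P.integrable_mult_ln[OF m_meas m_meas a mab mab]) (use that in auto)
    have 4: "(\<integral>y. f (x(k := y)) * ln (f (x(k := y))) \<partial>M k) = H k x + m k x * ln (m k x)" for x
      by (simp add: H_def m_def ent_def)
    show ?thesis
      using intB[OF that] int_H[OF that] 3 by (simp add: 2) (simp add: 1 4)
  qed
  have fabs: "\<bar>f x\<bar> \<le> b" if "x \<in> space P" for x
    using fab[OF that] a by auto
  have intA': "integrable P (\<lambda>x. 1 / \<kappa> * (f x * (H k x / m k x)))" if "k \<in> I" for k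
    by (rule integrable_mult_right[OF intA[OF that]])
  have intB': "integrable P (\<lambda>x. f x * ln (f x) - f x * ln (m k x))" if "k \<in> I" for k
    by (rule Bochner_Integration.integrable_diff[OF intB(2,1)[OF that]])
  have intZ: "integrable P (\<lambda>x. Z x * f x)"
    by (rule P.integrable_bounded[where C = "card I * b"])
      (use abs_Z_le fabs in \<open>auto simp: abs_mult intro!: mult_mono\<close>)
  have intf: "integrable P f"
    by (rule P.integrable_bounded[OF f fabs])
  have "(1 / \<kappa> - 1) * (\<Sum>k\<in>I. \<integral>x. H k x \<partial>P)
      = (\<Sum>k\<in>I. 1 / \<kappa> * (\<integral>x. f x * (H k x / m k x) \<partial>P) - (\<integral>x. f x * ln (f x) - f x * ln (m k x) \<partial>P))"
    unfolding sum_distrib_left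
  proof (rule sum.cong[OF refl])
    show "(1 / \<kappa> - 1) * (\<integral>x. H k x \<partial>P)
      = 1 / \<kappa> * (\<integral>x. f x * (H k x / m k x) \<partial>P) - (\<integral>x. f x * ln (f x) - f x * ln (m k x) \<partial>P)"
      if "k \<in> I" for k
      unfolding A[OF that] Bk[OF that] by (simp add: left_diff_distrib)
  qed
  also have "\<dots> = (\<integral>x. (\<Sum>k\<in>I. 1 / \<kappa> * (f x * (H k x / m k x)) - (f x * ln (f x) - f x * ln (m k x))) \<partial>P)"
    by (subst Bochner_Integration.integral_sum)
      (simp_all only: Bochner_Integration.integrable_diff[OF intA' intB']
        Bochner_Integration.integral_diff[OF intA' intB'] integral_mult_right_zero cong: sum.cong)
  also have "\<dots> \<le> (\<integral>x. t * (Z x * f x) + ent_coeff t * V / \<phi> * f x \<partial>P)"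
  proof (rule integral_mono)
    fix x assume x: "x \<in> space P"
    have "(\<Sum>k\<in>I. 1 / \<kappa> * (f x * (H k x / m k x)) - (f x * ln (f x) - f x * ln (m k x)))
        = f x * (\<Sum>k\<in>I. H k x / (\<kappa> * m k x) + (ln (m k x) - ln (f x)))"
      unfolding sum_distrib_left by (intro sum.cong) (simp_all add: algebra_simps)
    also have "\<dots> \<le> f x * (t * Z x + ent_coeff t * V / \<phi>)"
      using sum_coordinate_ent_le[OF \<open>0 < t\<close> x]
      by (intro mult_left_mono) (simp_all add: f_def m_def H_def \<phi>_def \<kappa>_def)
    finally show "(\<Sum>k\<in>I. 1 / \<kappa> * (f x * (H k x / m k x)) - (f x * ln (f x) - f x * ln (m k x)))
        \<le> t * (Z x * f x) + ent_coeff t * V / \<phi> * f x"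
      by (simp add: algebra_simps)
  qed (intro Bochner_Integration.integrable_sum Bochner_Integration.integrable_diff intA' intB'
      Bochner_Integration.integrable_add integrable_mult_right intZ intf; assumption)+
  also have "\<dots> = t * (\<integral>x. Z x * f x \<partial>P) + ent_coeff t * V / \<phi> * (\<integral>x. f x \<partial>P)"
    using intZ intf by simp
  finally have *: "(1 / \<kappa> - 1) * (\<Sum>k\<in>I. \<integral>x. H k x \<partial>P)
    \<le> t * (\<integral>x. Z x * f x \<partial>P) + ent_coeff t * V / \<phi> * (\<integral>x. f x \<partial>P)" .
  \<comment> \<open>Here \<open>\<kappa> \<le> 1\<close> supplies the sign with which tensorization
    can be multiplied.\<close>
  have "(1 - \<kappa>) * ent P f \<le> (1 - \<kappa>) * (\<Sum>k\<in>I. \<integral>x. H k x \<partial>P)"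
    unfolding H_def using \<open>\<kappa> \<le> 1\<close>
    by (intro mult_left_mono ent_tensorization[OF finite_I f a fab]) auto
  also have "\<dots> = \<kappa> * ((1 / \<kappa> - 1) * (\<Sum>k\<in>I. \<integral>x. H k x \<partial>P))"
    using \<kappa> by (simp add: field_simps)
  also have "\<dots> \<le> \<kappa> * (t * (\<integral>x. Z x * f x \<partial>P) + ent_coeff t * V / \<phi> * (\<integral>x. f x \<partial>P))"
    using * \<kappa> by (intro mult_left_mono) auto
  also have "\<dots> = \<kappa> * t * (\<integral>x. Z x * f x \<partial>P) + (1 + t / 2) * ent_coeff t * V * (\<integral>x. f x \<partial>P)"
    using \<phi> by (simp add: \<kappa>(1) field_simps)
  finally show ?thesis .
qed

end

subsection \<open>Numerical bounds for the differential inequality\<close>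

text \<open>Two integrations of \<open>exp x \<le> 1 + x + x\<^sup>2\<close>.\<close>

lemma exp_le_quartic:
  assumes "0 \<le> (x :: real)" "x \<le> 1"
  shows "exp x \<le> 1 + x + x\<^sup>2 / 2 + x ^ 3 / 6 + x ^ 4 / 12"
proof -
  have 0: "0 \<le> 1 + x + x\<^sup>2 - exp x" if "0 \<le> x" "x \<le> 1" for x :: real
    using exp_bound[OF that] by simp
  have 1: "0 \<le> 1 + x + x\<^sup>2 / 2 + x ^ 3 / 3 - exp x" if "0 \<le> x" "x \<le> 1" for x :: real
    by (rule nonneg_if_deriv_nonneg[where t = x and F' = "\<lambda>x. 1 + x + x\<^sup>2 - exp x"])
      (use that 0 in \<open>auto intro!: derivative_eq_intros simp: algebra_simps power2_eq_square\<close>)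
  have "0 \<le> 1 + x + x\<^sup>2 / 2 + x ^ 3 / 6 + x ^ 4 / 12 - exp x"
    by (rule nonneg_if_deriv_nonneg[where t = x and F' = "\<lambda>x. 1 + x + x\<^sup>2 / 2 + x ^ 3 / 3 - exp x"])
      (use assms 1 in \<open>auto intro!: derivative_eq_intros simp: algebra_simps power2_eq_square power3_eq_cube\<close>)
  then show ?thesis by simp
qed

definition laplace_bound :: "real \<Rightarrow> real"
  where "laplace_bound t = (exp (3 * t) - 3 * t - 1) / 9"

text \<open>The factor \<open>\<kappa>\<close> of \<open>ent_exp_Z_le\<close> as a function of
  \<open>t\<close>.\<close>

definition damping :: "real \<Rightarrow> real"
  where "damping t = (1 + t / 2) * (exp t - 1)"

lemma laplace_bound_ge:
  assumes "0 \<le> t" shows "t\<^sup>2 / 2 + t ^ 3 / 2 \<le> laplace_bound t"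
  using exp_ge_cubic[of "3 * t"] assms
  by (simp add: laplace_bound_def power2_eq_square power3_eq_cube)

lemma damping_pos: "0 < t \<Longrightarrow> 0 < damping t"
  by (simp add: damping_def)

lemma damping_ge:
  assumes "0 \<le> t" shows "t + t\<^sup>2 + t ^ 3 / 4 \<le> damping t"
proof -
  have "(1 + t / 2) * (t + t\<^sup>2 / 2) \<le> damping t"
    unfolding damping_def using assms exp_lower_Taylor_quadratic[of t] by (intro mult_left_mono) auto
  then show ?thesis by (simp add: field_simps power2_eq_square power3_eq_cube)
qed

text \<open>The cut \<open>11 / 20\<close> lies below the point where \<open>damping\<close> reaches
  1 and above the point from which \<open>t \<le> 2 * laplace_bound t\<close> holds, so the two
  regimes of \<open>t\<close> meet.\<close>

lemma damping_le_1:
  assumes "0 \<le> t" "t \<le> 11 / 20" shows "damping t \<le> 1"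
proof -
  have "exp t \<le> exp (11 / 20)" using assms by simp
  also have "\<dots> \<le> 1 + 11 / 20 + (11 / 20)\<^sup>2 / 2 + (11 / 20) ^ 3 / 6 + (11 / 20) ^ 4 / 12"
    by (rule exp_le_quartic) auto
  finally have "exp t \<le> 7 / 4" by (simp add: power_divide)
  then have "damping t \<le> (1 + (11 / 20) / 2) * (3 / 4)"
    unfolding damping_def using assms by (intro mult_mono) auto
  then show ?thesis by simp
qed

text \<open>The coefficient of \<open>V\<close> in the supersolution property of
  \<open>p = laplace_bound\<close>, as \<open>entropy_fn (3 * t) / 9 = t * p' t - p t\<close>. Both
  sides begin with \<open>t\<^sup>2 / 2\<close>; the cubic coefficients are 13/12 and 3/2, and this
  gap absorbs the fifth and sixth order terms.\<close>

lemma ent_coeff_le: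
  assumes "0 < t" "t \<le> 1"
  shows "(1 + t / 2) * ent_coeff t \<le> entropy_fn (3 * t) / 9 + damping t * laplace_bound t"
proof -
  have "(1 - t) * (1 + t + t\<^sup>2 / 2 + t ^ 3 / 6) \<le> (1 - t) * exp t"
    using assms exp_ge_cubic[of t] by (intro mult_left_mono) auto
  then have 1: "entropy_fn t \<le> t\<^sup>2 / 2 + t ^ 3 / 3 + t ^ 4 / 6"
    by (simp add: entropy_fn_def field_simps eval_nat_numeral)
  have up: "exp t \<le> 1 + t + t\<^sup>2 / 2 + t ^ 3 / 6 + t ^ 4 / 12"
    using assms by (intro exp_le_quartic) auto
  have "(exp t - 1) * (exp t - 1 - t)
      \<le> (t + t\<^sup>2 / 2 + t ^ 3 / 6 + t ^ 4 / 12) * (t\<^sup>2 / 2 + t ^ 3 / 6 + t ^ 4 / 12)"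
  proof (rule mult_mono)
    show "0 \<le> exp t - 1 - t" using exp_ge_add_one_self[of t] by linarith
  qed (use up assms in auto)
  also have "\<dots> = t ^ 3 / 2 + 5 / 12 * t ^ 4 + t ^ 4 * (t / 4 + t\<^sup>2 / 9 + t ^ 3 / 36 + t ^ 4 / 144)"
    by (simp add: field_simps eval_nat_numeral)
  also have "\<dots> \<le> t ^ 3 / 2 + 5 / 12 * t ^ 4 + t ^ 4 * (t / 2)"
  proof (intro add_left_mono mult_left_mono)
    have "t\<^sup>2 \<le> t" "t ^ 3 \<le> t" "t ^ 4 \<le> t"
      using power_decreasing[of 1 _ t] assms by auto
    then show "t / 4 + t\<^sup>2 / 9 + t ^ 3 / 36 + t ^ 4 / 144 \<le> t / 2"
      using assms by linarith
  qed simp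
  finally have 2: "(exp t - 1) * (exp t - 1 - t) \<le> t ^ 3 / 2 + 5 / 12 * t ^ 4 + t ^ 4 * (t / 2)" .
  have "(1 + t / 2) * ent_coeff t
      \<le> (1 + t / 2) * (t\<^sup>2 / 2 + 5 / 6 * t ^ 3 + 7 / 12 * t ^ 4 + t ^ 5 / 2)"
    using 1 2 assms by (intro mult_left_mono) (auto simp: ent_coeff_def eval_nat_numeral)
  also have "\<dots> = t\<^sup>2 / 2 + 13 / 12 * t ^ 3 + t ^ 4 + 19 / 24 * t ^ 5 + t ^ 6 / 4"
    by (simp add: field_simps eval_nat_numeral)
  also have "\<dots> \<le> t\<^sup>2 / 2 + 3 / 2 * t ^ 3 + t ^ 4 + 5 / 8 * t ^ 5 + t ^ 6 / 8"
  proof -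
    have "t ^ 5 \<le> t ^ 3" "t ^ 6 \<le> t ^ 3" "0 < t ^ 3"
      using power_decreasing[of 3 _ t] assms by auto
    then show ?thesis by linarith
  qed
  also have "\<dots> = ((3 * t)\<^sup>2 / 2 + (3 * t) ^ 3 / 3) / 9
      + (t + t\<^sup>2 + t ^ 3 / 4) * (t\<^sup>2 / 2 + t ^ 3 / 2)"
    by (simp add: field_simps eval_nat_numeral)
  also have "\<dots> \<le> entropy_fn (3 * t) / 9 + damping t * laplace_bound t"
    using assms damping_pos[of t]
    by (intro add_mono divide_right_mono entropy_fn_ge mult_mono damping_ge laplace_bound_ge) auto
  finally show ?thesis .
qed

text \<open>The coefficient of the expectation of \<open>Z\<close> in the same property. Write
  \<open>t = (t - t\<^sup>2) + t\<^sup>2\<close>: the first part is covered by the entropy term, the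
  second by \<open>t\<^sup>2 \<le> 2 * laplace_bound t\<close>.\<close>

lemma damping_le:
  assumes "0 < t" "t \<le> 1"
  shows "damping t * t \<le> 2 * (entropy_fn (3 * t) / 9 + damping t * laplace_bound t)"
proof -
  have "damping t * (t - t\<^sup>2) \<le> (1 + t / 2) * (t + t\<^sup>2) * (t - t\<^sup>2)"
    unfolding damping_def
    using assms exp_bound[of t] power_decreasing[of 1 2 t] by (intro mult_right_mono mult_left_mono) auto
  also have "\<dots> = t\<^sup>2 + t ^ 3 / 2 - t ^ 4 - t ^ 5 / 2"
    by (simp add: field_simps eval_nat_numeral)
  also have "\<dots> \<le> t\<^sup>2 + 2 * t ^ 3"
    using assms zero_less_power[of t 3] zero_less_power[of t 4] zero_less_power[of t 5] by linarith
  also have "\<dots> = 2 * (((3 * t)\<^sup>2 / 2 + (3 * t) ^ 3 / 3) / 9)"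
    by (simp add: power2_eq_square power3_eq_cube)
  also have "\<dots> \<le> 2 * (entropy_fn (3 * t) / 9)"
    using entropy_fn_ge[of "3 * t"] assms by simp
  finally have "damping t * t \<le> 2 * (entropy_fn (3 * t) / 9) + damping t * t\<^sup>2"
    by (simp add: algebra_simps)
  also have "damping t * t\<^sup>2 \<le> damping t * (2 * laplace_bound t)"
  proof (rule mult_left_mono)
    have "0 < t ^ 3" using assms by simp
    then show "t\<^sup>2 \<le> 2 * laplace_bound t"
      using laplace_bound_ge[of t] assms by linarith
  qed (use damping_pos[of t] assms in simp)
  finally show ?thesis by (simp add: algebra_simps)
qed

text \<open>This is \<open>exp_scaled_le\<close> with scale 1/3 at the point
  \<open>3 * t\<close>.\<close>

lemma exp_diff_le_laplace_bound:
  assumes "0 \<le> t" shows "exp t - 1 - t \<le> laplace_bound t"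
  using exp_scaled_le[of "1 / 3" "3 * t"] assms
  by (simp add: laplace_bound_def power_divide field_simps)

text \<open>A line through a lower estimate of \<open>exp (3 * t)\<close> at
  \<open>t = 11 / 20\<close>, where \<open>3 * t = 33 / 20\<close> and \<open>216 / 125\<close>
  bounds \<open>exp (11 / 20)\<close> from below.\<close>

lemma le_laplace_bound:
  assumes "11 / 20 \<le> t" shows "t \<le> 2 * laplace_bound t"
proof -
  have "(216 / 125) ^ 3 \<le> exp (11 / 20 :: real) ^ 3"
    using exp_ge_cubic[of "11 / 20"] by (intro power_mono) (auto simp: power_divide)
  also have "exp (11 / 20 :: real) ^ 3 = exp (33 / 20)"
    by (simp add: exp_of_nat_mult[symmetric])
  finally have "(216 / 125) ^ 3 * (1 + (3 * t - 33 / 20)) \<le> exp (33 / 20) * exp (3 * t - 33 / 20)"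
    using assms exp_ge_add_one_self[of "3 * t - 33 / 20"] by (intro mult_mono) auto
  also have "\<dots> = exp (3 * t)" by (simp add: exp_add[symmetric])
  finally show ?thesis using assms by (simp add: laplace_bound_def field_simps)
qed

text \<open>A comparison principle for an inequality singular at 0. The hypothesis
  \<open>D' 0 = 0\<close> matters: \<open>D t = t * exp (- t)\<close> with
  \<open>\<kappa> t = t\<close> satisfies the inequality and \<open>D 0 = 0\<close>, yet is
  positive.\<close>

lemma nonpos_if_deriv_le:
  fixes D D' \<kappa> :: "real \<Rightarrow> real"
  assumes deriv: "\<And>t. 0 \<le> t \<Longrightarrow> t \<le> T \<Longrightarrow> (D has_real_derivative D' t) (at t)"
    and "D 0 = 0" "D' 0 = 0"
    and le: "\<And>t. 0 < t \<Longrightarrow> t \<le> T \<Longrightarrow> t * D' t \<le> (1 - \<kappa> t) * D t"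
    and \<kappa>: "\<And>t. 0 < t \<Longrightarrow> t \<le> T \<Longrightarrow> 0 < \<kappa> t"
    and "0 \<le> T"
  shows "D T \<le> 0"
proof (rule ccontr)
  assume "\<not> D T \<le> 0"
  then have "0 < T" using \<open>D 0 = 0\<close> \<open>0 \<le> T\<close> by (cases "T = 0") auto
  \<comment> \<open>The junk value \<open>?q 0 = 0\<close> is the limit of \<open>?q\<close> at \<open>0\<close>; at a positive maximum \<open>?q\<close> would be
    strictly decreasing.\<close>
  let ?q = "\<lambda>t. D t / t"
  have "isCont ?q t" if "0 \<le> t" "t \<le> T" for t
  proof (cases "t = 0")
    case True
    have "((\<lambda>h. (D (0 + h) - D 0) / h) \<longlongrightarrow> D' 0) (at 0)"
      using deriv[of 0] \<open>0 \<le> T\<close> by (simp add: DERIV_def)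
    then show ?thesis using True \<open>D 0 = 0\<close> \<open>D' 0 = 0\<close> by (simp add: isCont_def)
  next
    case False
    then show ?thesis using DERIV_isCont[OF deriv[OF that]] by (intro continuous_intros) auto
  qed
  then have "continuous_on {0..T} ?q" by (intro continuous_at_imp_continuous_on) auto
  then obtain r where r: "r \<in> {0..T}" "\<And>t. t \<in> {0..T} \<Longrightarrow> ?q t \<le> ?q r"
    using continuous_attains_sup[of "{0..T}" ?q] \<open>0 \<le> T\<close> by auto
  have "0 < ?q T" using \<open>\<not> D T \<le> 0\<close> \<open>0 < T\<close> by simp
  then have q: "0 < ?q r" using r(2)[of T] \<open>0 \<le> T\<close> by simp
  then have r0: "0 < r" using r(1) by (cases "r = 0") auto
  then have Dr: "0 < D r" using q by (simp add: zero_less_divide_iff)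
  have "(?q has_real_derivative (D' r * r - D r) / (r * r)) (at r)"
    using deriv[of r] r r0 by (auto intro!: derivative_eq_intros)
  moreover have "(D' r * r - D r) / (r * r) < 0"
  proof -
    have "0 < \<kappa> r * D r" using \<kappa>[OF r0] r Dr by simp
    then have "D' r * r - D r < 0" using le[OF r0] r by (simp add: algebra_simps)
    then show ?thesis using r0 by (simp add: divide_neg_pos)
  qed
  ultimately obtain d where d: "0 < d" "\<And>h. 0 < h \<Longrightarrow> h < d \<Longrightarrow> ?q r < ?q (r - h)"
    using DERIV_neg_dec_left by blast
  define h where "h = min (d / 2) (r / 2)"
  have "0 < h" "h < d" "r - h \<in> {0..T}" using d(1) r0 r(1) by (auto simp: h_def min_def)
  then show False using d(2)[of h] r(2)[of "r - h"] by simp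
qed

text \<open>Differentiation under the integral with an explicit remainder: for
  \<open>\<bar>u\<bar> \<le> 1\<close>, \<open>exp u - 1 - u\<close> lies between 0 and
  \<open>u\<^sup>2 * (exp 1 - 2)\<close>, so the difference quotient is off by at most
  \<open>K * \<bar>h\<bar>\<close>.\<close>

lemma (in prob_space) laplace_transform_deriv:
  fixes Y :: "'a \<Rightarrow> real"
  assumes [measurable]: "Y \<in> borel_measurable M"
    and Y: "\<And>x. x \<in> space M \<Longrightarrow> \<bar>Y x\<bar> \<le> C" and "0 \<le> C"
  shows "((\<lambda>t. \<integral>x. exp (- t * Y x) \<partial>M) has_real_derivative - (\<integral>x. Y x * exp (- t * Y x) \<partial>M)) (at t)"
proof -
  let ?F = "\<lambda>t. \<integral>x. exp (- t * Y x) \<partial>M"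
  let ?D = "- (\<integral>x. Y x * exp (- t * Y x) \<partial>M)"
  define K where "K = exp (\<bar>t\<bar> * C) * (C\<^sup>2 * (exp 1 - 2))"
  have bd: "exp (- u * Y x) \<le> exp (\<bar>u\<bar> * C)" if "x \<in> space M" for u x
  proof -
    have "- u * Y x \<le> \<bar>u\<bar> * \<bar>Y x\<bar>" by (metis abs_ge_self abs_minus_cancel abs_mult)
    also have "\<dots> \<le> \<bar>u\<bar> * C" using Y[OF that] by (intro mult_left_mono) auto
    finally show ?thesis by simp
  qed
  have int: "integrable M (\<lambda>x. exp (- u * Y x))" for u
    by (rule integrable_bounded[where C = "exp (\<bar>u\<bar> * C)"]) (use bd in auto)
  have intY: "integrable M (\<lambda>x. Y x * exp (- t * Y x))"
    by (rule integrable_bounded[where C = "C * exp (\<bar>t\<bar> * C)"])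
      (use bd Y \<open>0 \<le> C\<close> in \<open>auto simp: abs_mult intro!: mult_mono\<close>)
  have "\<bar>(?F (t + h) - ?F t) / h - ?D\<bar> \<le> K * \<bar>h\<bar>" if h: "h \<noteq> 0" "\<bar>h\<bar> * C \<le> 1" for h
  proof -
    have pt: "\<bar>exp (- (t + h) * Y x) - exp (- t * Y x) + h * (Y x * exp (- t * Y x))\<bar> \<le> K * h\<^sup>2"
      if x: "x \<in> space M" for x
    proof -
      let ?u = "- h * Y x"
      have "\<bar>?u\<bar> \<le> \<bar>h\<bar> * C" using Y[OF x] by (simp add: abs_mult mult_left_mono)
      then have "\<bar>?u\<bar> \<le> 1" using h by simp
      then have "exp ?u \<le> 1 + ?u + ?u\<^sup>2 * (exp 1 - 2)"
        using exp_scaled_le[of ?u 1] by simp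
      moreover have "1 + ?u \<le> exp ?u" by (rule exp_ge_add_one_self)
      moreover have "?u\<^sup>2 * (exp 1 - 2) \<le> (\<bar>h\<bar> * C)\<^sup>2 * (exp 1 - 2)"
        using \<open>\<bar>?u\<bar> \<le> \<bar>h\<bar> * C\<close> exp_ge_add_one_self[of 1]
        by (intro mult_right_mono) (auto simp: abs_le_square_iff[symmetric] \<open>0 \<le> C\<close>)
      ultimately have "\<bar>exp ?u - 1 - ?u\<bar> \<le> C\<^sup>2 * (exp 1 - 2) * h\<^sup>2"
        by (simp add: power_mult_distrib mult_ac)
      then have "exp (- t * Y x) * \<bar>exp ?u - 1 - ?u\<bar> \<le> exp (\<bar>t\<bar> * C) * (C\<^sup>2 * (exp 1 - 2) * h\<^sup>2)"
        using bd[OF x, of t] by (intro mult_mono) auto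
      moreover have "exp (- (t + h) * Y x) - exp (- t * Y x) + h * (Y x * exp (- t * Y x))
          = exp (- t * Y x) * (exp ?u - 1 - ?u)"
        by (simp add: exp_add[symmetric] algebra_simps)
      ultimately show ?thesis by (simp add: abs_mult K_def mult_ac)
    qed
    have "\<bar>(\<integral>x. exp (- (t + h) * Y x) - exp (- t * Y x) + h * (Y x * exp (- t * Y x)) \<partial>M)\<bar> \<le> K * h\<^sup>2"
      by (rule abs_integral_le[OF _ pt]) measurable
    also have "(\<integral>x. exp (- (t + h) * Y x) - exp (- t * Y x) + h * (Y x * exp (- t * Y x)) \<partial>M)
        = ?F (t + h) - ?F t - h * ?D"
      using int[of "t + h"] int[of t] intY by simp
    finally have "\<bar>?F (t + h) - ?F t - h * ?D\<bar> / \<bar>h\<bar> \<le> K * h\<^sup>2 / \<bar>h\<bar>"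
      by (rule divide_right_mono) simp
    moreover have "\<bar>?F (t + h) - ?F t - h * ?D\<bar> / \<bar>h\<bar> = \<bar>(?F (t + h) - ?F t) / h - ?D\<bar>"
      using h by (simp only: abs_divide[symmetric] diff_divide_distrib) simp
    moreover have "K * h\<^sup>2 / \<bar>h\<bar> = K * \<bar>h\<bar>"
      using h by (simp add: power2_eq_square abs_if)
    ultimately show ?thesis by simp
  qed
  moreover have "\<forall>\<^sub>F h in at 0. h \<noteq> 0 \<and> \<bar>h\<bar> * C \<le> 1"
  proof -
    have "\<forall>\<^sub>F h in at (0::real). \<bar>h\<bar> < 1 / (C + 1)"
      using \<open>0 \<le> C\<close> by (intro order_tendstoD(2)[of _ "0"] tendsto_rabs_zero tendsto_ident_at) auto
    then show ?thesis
      using eventually_neq_at_within[of 0 0 UNIV]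
    proof eventually_elim
      case (elim h)
      then have "\<bar>h\<bar> * (C + 1) < 1" using \<open>0 \<le> C\<close> by (simp add: field_simps)
      then show ?case using elim by (simp add: algebra_simps)
    qed
  qed
  ultimately have "\<forall>\<^sub>F h in at 0. norm ((?F (t + h) - ?F t) / h - ?D) \<le> K * \<bar>h\<bar>"
    by (auto elim: eventually_mono)
  moreover have "((\<lambda>h. K * \<bar>h\<bar>) \<longlongrightarrow> 0) (at 0)"
    by (auto intro!: tendsto_eq_intros)
  ultimately have "((\<lambda>h. (?F (t + h) - ?F t) / h - ?D) \<longlongrightarrow> 0) (at 0)"
    by (rule Lim_null_comparison)
  then show ?thesis
    unfolding DERIV_def by (rule Lim_null[THEN iffD2])
qed

subsection \<open>The log-Laplace transform of the supremum\<close>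

context centered_class
begin

lemma component_measurable:
  assumes "s \<in> \<S>" "k \<in> I" shows "(\<lambda>x. s k (x k)) \<in> borel_measurable P"
  using measurable_component_singleton[OF assms(2)] S_meas[OF assms] by (rule measurable_compose)

lemma abs_component_le:
  assumes "s \<in> \<S>" "k \<in> I" "x \<in> space P" shows "\<bar>s k (x k)\<bar> \<le> 1"
  using assms by (intro S_le) (auto simp: space_PiM)

lemma integral_component:
  assumes "s \<in> \<S>" "k \<in> I" shows "(\<integral>x. s k (x k) \<partial>P) = 0"
proof -
  have "(\<integral>x. s k (x k) \<partial>P) = (\<integral>x. (\<integral>y. s k ((x(k := y)) k) \<partial>M k) \<partial>P)"
    by (rule integral_resample[OF finite_I assms(2) component_measurable[OF assms]])
      (rule abs_component_le[OF assms])
  then show ?thesis using S_0[OF assms] by simp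
qed

lemma integral_part_sum:
  assumes "s \<in> \<S>" shows "(\<integral>x. part_sum s x \<partial>P) = 0"
proof -
  have "integrable P (\<lambda>x. s k (x k))" if "k \<in> I" for k
    by (rule P.integrable_bounded[where C = 1, OF component_measurable[OF assms that]])
      (rule abs_component_le[OF assms that])
  then show ?thesis
    by (simp add: part_sum_def Bochner_Integration.integral_sum integral_component assms)
qed

text \<open>Distinct components are orthogonal: resampling coordinate \<open>k\<close> keeps
  \<open>s j (x j)\<close> fixed and averages \<open>s k\<close> to 0.\<close>

lemma integral_part_sum_square:
  assumes "s \<in> \<S>"
  shows "(\<integral>x. (part_sum s x)\<^sup>2 \<partial>P) = (\<Sum>k\<in>I. \<integral>y. (s k y)\<^sup>2 \<partial>M k)"
proof -
  have meas: "(\<lambda>x. s j (x j) * s k (x k)) \<in> borel_measurable P" if "j \<in> I" "k \<in> I" for j k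
    by (intro borel_measurable_times component_measurable assms that)
  have le: "\<bar>s j (x j) * s k (x k)\<bar> \<le> 1" if "j \<in> I" "k \<in> I" "x \<in> space P" for j k x
    unfolding abs_mult using abs_component_le[OF assms] that by (intro mult_le_one) auto
  have int: "integrable P (\<lambda>x. s j (x j) * s k (x k))" if "j \<in> I" "k \<in> I" for j k
    by (rule P.integrable_bounded[OF meas le]) (use that in auto)
  have cov: "(\<integral>x. s j (x j) * s k (x k) \<partial>P) = (if j = k then \<integral>y. (s k y)\<^sup>2 \<partial>M k else 0)"
    if "j \<in> I" "k \<in> I" for j k
  proof -
    have "(\<integral>x. s j (x j) * s k (x k) \<partial>P)
        = (\<integral>x. (\<integral>y. s j ((x(k := y)) j) * s k ((x(k := y)) k) \<partial>M k) \<partial>P)"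
      by (rule integral_resample[OF finite_I that(2) meas[OF that] le[OF that]])
    then show ?thesis
      using S_0[OF assms that(2)] by (auto simp: P.prob_space power2_eq_square)
  qed
  have "(\<integral>x. (part_sum s x)\<^sup>2 \<partial>P) = (\<integral>x. (\<Sum>j\<in>I. \<Sum>k\<in>I. s j (x j) * s k (x k)) \<partial>P)"
    by (simp add: part_sum_def power2_eq_square sum_product)
  also have "\<dots> = (\<Sum>j\<in>I. \<Sum>k\<in>I. \<integral>x. s j (x j) * s k (x k) \<partial>P)"
    using int by (simp add: Bochner_Integration.integral_sum Bochner_Integration.integrable_sum)
  also have "\<dots> = (\<Sum>j\<in>I. \<Sum>k\<in>I. if j = k then \<integral>y. (s k y)\<^sup>2 \<partial>M k else 0)"
    by (intro sum.cong refl cov)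
  also have "\<dots> = (\<Sum>k\<in>I. \<integral>y. (s k y)\<^sup>2 \<partial>M k)"
    using finite_I by simp
  finally show ?thesis .
qed

lemma integrable_Z: "integrable P Z"
  by (rule P.integrable_bounded[OF Z_measurable abs_Z_le])

lemma integral_Z_nonneg: "0 \<le> (\<integral>x. Z x \<partial>P)"
proof -
  obtain s where s: "s \<in> \<S>" using S_ne by blast
  have "integrable P (part_sum s)"
    by (rule P.integrable_bounded[OF part_sum_measurable[OF s] abs_part_sum_le[OF s]])
  then have "(\<integral>x. part_sum s x \<partial>P) \<le> (\<integral>x. Z x \<partial>P)"
    by (intro integral_mono integrable_Z part_sum_le_Z s)
  then show ?thesis by (simp add: integral_part_sum s)
qed

lemma exp_Z_le:
  assumes "x \<in> space P" shows "\<bar>exp (- t * Z x)\<bar> \<le> exp (\<bar>t\<bar> * card I)"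
proof -
  have "- t * Z x \<le> \<bar>t\<bar> * \<bar>Z x\<bar>" by (metis abs_ge_self abs_minus_cancel abs_mult)
  also have "\<dots> \<le> \<bar>t\<bar> * card I" using abs_Z_le[OF assms] by (intro mult_left_mono) auto
  finally show ?thesis by simp
qed

lemma integrable_exp_Z: "integrable P (\<lambda>x. exp (- t * Z x))"
  by (rule P.integrable_bounded[OF _ exp_Z_le]) measurable

lemma laplace_Z_pos: "0 < (\<integral>x. exp (- t * Z x) \<partial>P)"
proof -
  have "exp (- \<bar>t\<bar> * card I) \<le> exp (- t * Z x)" if "x \<in> space P" for x
  proof -
    have "t * Z x \<le> \<bar>t\<bar> * \<bar>Z x\<bar>" by (metis abs_ge_self abs_mult)
    also have "\<dots> \<le> \<bar>t\<bar> * card I" using abs_Z_le[OF that] by (intro mult_left_mono) auto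
    finally show ?thesis by simp
  qed
  then have "exp (- \<bar>t\<bar> * card I) \<le> (\<integral>x. exp (- t * Z x) \<partial>P)"
    by (intro P.integral_ge_const integrable_exp_Z) auto
  then show ?thesis by (rule less_le_trans[rotated]) simp
qed

text \<open>Bennett's estimate for a single sum below \<open>Z\<close>: the transform factorizes
  over the coordinates.\<close>

lemma laplace_Z_le_exp:
  assumes "0 \<le> t"
  shows "(\<integral>x. exp (- t * Z x) \<partial>P) \<le> exp (V * (exp t - 1 - t))"
proof -
  obtain s where s: "s \<in> \<S>" using S_ne by blast
  let ?K = "exp t - 1 - t"
  have K: "0 \<le> ?K" using exp_ge_add_one_self[of t] by linarith
  have int: "integrable (M k) (\<lambda>y. exp (- t * s k y))" if "k \<in> I" for k
  proof (rule prob_space.integrable_bounded[OF prob])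
    have [measurable]: "s k \<in> borel_measurable (M k)" by (rule S_meas[OF s that])
    show "(\<lambda>y. exp (- t * s k y)) \<in> borel_measurable (M k)" by measurable
    show "\<bar>exp (- t * s k y)\<bar> \<le> exp t" if "y \<in> space (M k)" for y
      using S_le[OF s \<open>k \<in> I\<close> that] mult_left_mono[of "- s k y" 1 t] assms by (simp add: abs_le_iff)
  qed
  have "(\<integral>x. exp (- t * Z x) \<partial>P) \<le> (\<integral>x. (\<Prod>k\<in>I. exp (- t * s k (x k))) \<partial>P)"
  proof (rule integral_mono[OF integrable_exp_Z])
    show "integrable P (\<lambda>x. \<Prod>k\<in>I. exp (- t * s k (x k)))"
      by (rule product_integrable_prod[OF finite_I int])
    show "exp (- t * Z x) \<le> (\<Prod>k\<in>I. exp (- t * s k (x k)))" if "x \<in> space P" for x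
    proof -
      have "(\<Prod>k\<in>I. exp (- t * s k (x k))) = exp (- t * part_sum s x)"
        by (simp add: exp_sum[OF finite_I, symmetric] part_sum_def sum_distrib_left sum_negf)
      then show ?thesis
        using part_sum_le_Z[OF s that] assms by (simp add: mult_left_mono)
    qed
  qed
  also have "\<dots> = (\<Prod>k\<in>I. \<integral>y. exp (- t * s k y) \<partial>M k)"
    by (rule product_integral_prod[OF finite_I int])
  also have "\<dots> \<le> (\<Prod>k\<in>I. exp ((\<integral>y. (s k y)\<^sup>2 \<partial>M k) * ?K))"
  proof (rule prod_mono)
    fix k assume k: "k \<in> I"
    have "(\<integral>y. exp (- t * s k y) \<partial>M k) \<le> 1 + (\<integral>y. (s k y)\<^sup>2 \<partial>M k) * ?K"
      by (rule prob_space.integral_exp_scaled_le[OF prob])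
        (use S_meas[OF s k] S_le[OF s k] S_0[OF s k] assms in auto)
    also have "\<dots> \<le> exp ((\<integral>y. (s k y)\<^sup>2 \<partial>M k) * ?K)" by (rule exp_ge_add_one_self)
    finally show "0 \<le> (\<integral>y. exp (- t * s k y) \<partial>M k) \<and>
        (\<integral>y. exp (- t * s k y) \<partial>M k) \<le> exp ((\<integral>y. (s k y)\<^sup>2 \<partial>M k) * ?K)"
      by (simp add: integral_nonneg_AE)
  qed
  also have "\<dots> = exp ((\<Sum>k\<in>I. \<integral>y. (s k y)\<^sup>2 \<partial>M k) * ?K)"
    by (simp add: exp_sum[OF finite_I, symmetric] sum_distrib_right)
  also have "\<dots> \<le> exp (V * ?K)" using mult_right_mono[OF V[OF s] K] by simp
  finally show ?thesis .
qed

theorem log_laplace_Z_le: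
  assumes "0 < t"
  shows "ln (\<integral>x. exp (- t * Z x) \<partial>P)
    \<le> - t * (\<integral>x. Z x \<partial>P) + (2 * (\<integral>x. Z x \<partial>P) + V) * laplace_bound t"
proof (cases "t \<le> 11 / 20")
  \<comment> \<open>Here \<open>t \<le> 2 * laplace_bound t\<close> makes the total contribution of
    the expectation nonnegative, so a bound by \<open>V * laplace_bound t\<close> is enough.\<close>
  case False
  let ?E = "\<integral>x. Z x \<partial>P"
  have "ln (\<integral>x. exp (- t * Z x) \<partial>P) \<le> ln (exp (V * (exp t - 1 - t)))"
    using laplace_Z_le_exp[of t] laplace_Z_pos[of t] assms by (intro ln_mono) auto
  then have "ln (\<integral>x. exp (- t * Z x) \<partial>P) \<le> V * (exp t - 1 - t)" by simp
  also have "\<dots> \<le> V * laplace_bound t"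
    using exp_diff_le_laplace_bound[of t] assms V_nonneg by (intro mult_left_mono) auto
  moreover have "t * ?E \<le> 2 * laplace_bound t * ?E"
    using le_laplace_bound[of t] False integral_Z_nonneg by (intro mult_right_mono) auto
  ultimately show ?thesis by (simp add: algebra_simps)
next
  case True
  define E where "E = (\<integral>x. Z x \<partial>P)"
  define F where "F u = (\<integral>x. exp (- u * Z x) \<partial>P)" for u
  define G where "G u = (\<integral>x. Z x * exp (- u * Z x) \<partial>P)" for u
  define v where "v = 2 * E + V"
  \<comment> \<open>The excess of the log-Laplace transform over the claimed bound, to be shown
    nonpositive by the comparison principle.\<close>
  define D where "D u = ln (F u) + u * E - v * laplace_bound u" for u
  define D' where "D' u = - G u / F u + E - v * ((exp (3 * u) - 1) / 3)" for u
  have F: "0 < F u" for u unfolding F_def by (rule laplace_Z_pos)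
  have E: "0 \<le> E" unfolding E_def by (rule integral_Z_nonneg)
  have dF: "(F has_real_derivative - G u) (at u)" for u
    unfolding F_def G_def by (rule P.laplace_transform_deriv[OF Z_measurable abs_Z_le]) auto
  have F0: "F 0 = 1" and G0: "G 0 = E" by (simp_all add: F_def G_def E_def P.prob_space)
  have "D t \<le> 0"
  proof (rule nonpos_if_deriv_le[where D = D and T = t and D' = D' and \<kappa> = damping])
    show "(D has_real_derivative D' u) (at u)" for u
      unfolding D_def D'_def laplace_bound_def using F[of u]
      by (auto intro!: derivative_eq_intros dF simp: field_simps)
    show "D 0 = 0" "D' 0 = 0" by (simp_all add: D_def D'_def laplace_bound_def F0 G0)
    show "0 < damping u" if "0 < u" for u by (rule damping_pos[OF that])
    show "0 \<le> t" using assms by simp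
    show "u * D' u \<le> (1 - damping u) * D u" if u: "0 < u" "u \<le> t" for u
    proof -
      let ?\<kappa> = "damping u" and ?p = "laplace_bound u" and ?w = "entropy_fn (3 * u) / 9"
      let ?B = "(1 + u / 2) * ent_coeff u"
      have ent: "ent P (\<lambda>x. exp (- u * Z x)) = - u * G u - F u * ln (F u)"
        by (simp add: ent_def F_def G_def mult_ac)
      have "(1 - ?\<kappa>) * (- u * G u - F u * ln (F u)) \<le> ?\<kappa> * u * G u + ?B * V * F u"
        using ent_exp_Z_le[OF u(1)] damping_le_1[of u] u True
        unfolding ent F_def[symmetric] G_def[symmetric] damping_def by simp
      \<comment> \<open>Dividing by \<open>F u\<close> exposes \<open>- G u / F u\<close>, the
        derivative of \<open>ln (F u)\<close>.\<close>
      then have "- u * G u \<le> ((1 - ?\<kappa>) * ln (F u) + ?B * V) * F u"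
        by (simp add: algebra_simps)
      then have "- u * G u / F u \<le> (1 - ?\<kappa>) * ln (F u) + ?B * V"
        by (simp only: pos_divide_le_eq[OF F])
      then have 1: "u * (- G u / F u) \<le> (1 - ?\<kappa>) * ln (F u) + ?B * V" by simp
      \<comment> \<open>Facts 2 and 3 are the two parts of the supersolution property, for
        \<open>V\<close> and for \<open>E\<close>; fact 4 rewrites \<open>u * p' u\<close> as
        \<open>?w + ?p\<close>.\<close>
      have 2: "?B * V \<le> (?w + ?\<kappa> * ?p) * V"
        using ent_coeff_le[of u] u True V_nonneg by (intro mult_right_mono) auto
      have 3: "?\<kappa> * u * E \<le> 2 * (?w + ?\<kappa> * ?p) * E"
        using damping_le[of u] u True E by (intro mult_right_mono) auto
      have 4: "u * ((exp (3 * u) - 1) / 3) = ?w + ?p"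
        by (simp add: entropy_fn_def laplace_bound_def field_simps)
      have "u * D' u = u * (- G u / F u) + u * E - v * (u * ((exp (3 * u) - 1) / 3))"
        by (simp add: D'_def algebra_simps)
      also have "\<dots> \<le> (1 - ?\<kappa>) * ln (F u) + (?w + ?\<kappa> * ?p) * V + u * E - v * (?w + ?p)"
        unfolding 4 using 1 2 by linarith
      also have "\<dots> \<le> (1 - ?\<kappa>) * D u"
        using 3 by (simp add: D_def v_def algebra_simps add_divide_distrib)
      finally show ?thesis .
    qed
  qed
  then show ?thesis by (simp add: D_def F_def E_def v_def algebra_simps)
qed

end

section \<open>Chernoff's bound and a rational majorant of \<open>laplace_bound\<close>\<close>

context prob_space
begin

lemma laplace_tail_bound:
  fixes Y :: "'a \<Rightarrow> real"
  assumes int: "\<And>t. integrable M (\<lambda>x. exp (- t * Y x))"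
    and L: "ln (\<integral>x. exp (- t * Y x) \<partial>M) \<le> - t * EY + v * laplace_bound t" and "0 < t"
  shows "prob {x \<in> space M. Y x \<le> EY - z} \<le> exp (v * laplace_bound t - t * z)"
proof -
  \<comment> \<open>Positivity is needed to undo the logarithm, whose value at 0 carries no
    information.\<close>
  have pos: "0 < (\<integral>x. exp (- t * Y x) \<partial>M)"
  proof -
    have "(\<integral>x. exp (- t * Y x) \<partial>M) \<noteq> 0"
      using integral_nonneg_eq_0_iff_AE[OF int[of t]] by (auto simp: AE_False)
    then show ?thesis by (simp add: order_less_le integral_nonneg_AE)
  qed
  have "prob {x \<in> space M. Y x \<le> EY - z}
      \<le> exp (t * (EY - z)) * (\<integral>x\<in>space M. exp (- t * Y x) \<partial>M)"
    using integrable_mult_indicator[OF sets.top int[of t]] \<open>0 < t\<close>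
    by (intro Chernoff_ineq_le) (auto simp: set_integrable_def)
  also have "\<dots> = exp (t * (EY - z)) * exp (ln (\<integral>x. exp (- t * Y x) \<partial>M))"
    unfolding set_integral_space[OF int[of t]] using pos by simp
  also have "\<dots> \<le> exp (t * (EY - z)) * exp (- t * EY + v * laplace_bound t)"
    using L by simp
  also have "\<dots> = exp (v * laplace_bound t - t * z)"
    by (simp add: exp_add[symmetric] algebra_simps)
  finally show ?thesis .
qed

end

text \<open>After clearing the denominator, the second derivative of the difference in
  \<open>x = 3 * t\<close> is \<open>entropy_fn x\<close>.\<close>

lemma laplace_bound_le:
  assumes "0 \<le> t" "t < 1"
  shows "laplace_bound t \<le> t\<^sup>2 / (2 * (1 - t))"
proof -
  have 0: "0 \<le> x + 2 + (x - 2) * exp x" if "0 \<le> x" for x :: real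
    by (rule nonneg_if_deriv_nonneg[where t = x and F' = entropy_fn])
      (auto intro!: derivative_eq_intros entropy_fn_nonneg that, auto simp: entropy_fn_def algebra_simps)
  have "0 \<le> 3 * (3 * t)\<^sup>2 / 2 - (3 - 3 * t) * (exp (3 * t) - 3 * t - 1)"
    by (rule nonneg_if_deriv_nonneg[where t = "3 * t" and F' = "\<lambda>x. x + 2 + (x - 2) * exp x"
          and F = "\<lambda>x. 3 * x\<^sup>2 / 2 - (3 - x) * (exp x - x - 1)"])
      (auto intro!: derivative_eq_intros 0 simp: assms, auto simp: algebra_simps)
  then show ?thesis using assms by (simp add: laplace_bound_def field_simps power2_eq_square)
qed

subsection \<open>Tail bounds\<close>

text \<open>The chosen \<open>t\<close> minimizes \<open>v * laplace_bound t - t * x\<close>: it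
  solves \<open>v * (exp (3 * t) - 1) / 3 = x\<close>.\<close>

lemma bennett_exponent:
  assumes "0 < v" "0 < x"
  defines "t \<equiv> ln (1 + 3 * x / v) / 3"
  shows "0 < t" "v * laplace_bound t - t * x = - (v / 9) * bennett_h (3 * x / v)"
proof -
  have "0 < 3 * x / v" using assms by simp
  then show "0 < t" unfolding t_def by simp
  have "exp (3 * t) = 1 + 3 * x / v" using \<open>0 < 3 * x / v\<close> by (simp add: t_def)
  then have "v * laplace_bound t - t * x = v / 9 * (3 * x / v - 3 * t) - t * x"
    by (simp add: laplace_bound_def)
  also have "\<dots> = x / 3 - (v / 3 + x) * t" using assms by (simp add: field_simps)
  also have "\<dots> = - (v / 9) * bennett_h (3 * x / v)"
    unfolding bennett_h_def t_def using assms(1,2) by (simp add: field_simps)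
  finally show "v * laplace_bound t - t * x = - (v / 9) * bennett_h (3 * x / v)" .
qed

text \<open>Minimize \<open>v * t\<^sup>2 / (2 * (1 - t)) - t * x\<close> instead: the critical
  point has \<open>1 - t = v / w\<close>, and the minimum is
  \<open>- (w - v)\<^sup>2 / (2 * v)\<close>.\<close>

lemma bernstein_exponent:
  assumes "0 < v" "0 < x"
  shows "\<exists>t>0. v * laplace_bound t - t * x \<le> - (x\<^sup>2 / (v + sqrt (v\<^sup>2 + 2 * v * x) + x))"
proof -
  define w where "w = sqrt (v\<^sup>2 + 2 * v * x)"
  have w2: "w\<^sup>2 = v\<^sup>2 + 2 * v * x" using assms by (simp add: w_def)
  have "sqrt (v\<^sup>2) < w" unfolding w_def using assms by (subst real_sqrt_less_iff) simp
  then have vw: "v < w" using assms by simp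
  have w: "0 < w" using vw assms by linarith
  define t where "t = (w - v) / w"
  have t: "0 < t" "t < 1" "1 - t = v / w"
    using vw w assms by (simp_all add: t_def field_simps)
  have x: "x = (w - v) * (w + v) / (2 * v)"
    using w2 assms by (simp add: field_simps power2_eq_square)
  have den: "v + w + x = (w + v)\<^sup>2 / (2 * v)"
    using assms by (simp add: x field_simps power2_eq_square)
  have "v * laplace_bound t \<le> v * (t\<^sup>2 / (2 * (1 - t)))"
    using laplace_bound_le[of t] t assms by (intro mult_left_mono) auto
  also have "\<dots> = (w - v)\<^sup>2 / (2 * w)"
    unfolding t(3) using w assms by (simp add: t_def field_simps power2_eq_square)
  also have "\<dots> = t * x - (w - v)\<^sup>2 / (2 * v)"
    unfolding x using w assms by (simp add: t_def field_simps power2_eq_square)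
  also have "(w - v)\<^sup>2 / (2 * v) = x\<^sup>2 / (v + w + x)"
  proof -
    have "x\<^sup>2 = (w - v)\<^sup>2 / (2 * v) * ((w + v)\<^sup>2 / (2 * v))"
      unfolding x by (simp add: power_divide power_mult_distrib power2_eq_square)
    then show ?thesis unfolding den using w assms by simp
  qed
  finally show ?thesis using t(1) unfolding w_def by auto
qed

lemma bernstein_bound_mono:
  fixes v x :: real
  assumes "0 \<le> v" "0 < x"
  shows "exp (- (x\<^sup>2 / (v + sqrt (v\<^sup>2 + 2 * v * x) + x))) \<le> exp (- (x\<^sup>2 / (2 * v + 2 * x)))"
proof -
  have "sqrt (v\<^sup>2 + 2 * v * x) \<le> v + x"
    using assms by (intro real_le_lsqrt) (auto simp: power2_eq_square algebra_simps)
  moreover have "0 < v + sqrt (v\<^sup>2 + 2 * v * x) + x"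
    using assms by (intro add_nonneg_pos add_nonneg_nonneg) auto
  ultimately have "x\<^sup>2 / (2 * v + 2 * x) \<le> x\<^sup>2 / (v + sqrt (v\<^sup>2 + 2 * v * x) + x)"
    using assms by (intro divide_left_mono mult_pos_pos) auto
  then show ?thesis by simp
qed

section \<open>Transfer from the product space to the random variables through their joint
  law\<close>

theorem theorem1p2:
  fixes M :: "'w measure"
    and n :: nat
    and X :: "nat \<Rightarrow> 'w \<Rightarrow> 'a :: polish_space"
    and \<S> :: "(nat \<Rightarrow> 'a \<Rightarrow> real) set"
  assumes "prob_space M"
    and "1 \<le> n"
    and "prob_space.indep_vars M (\<lambda>_. borel) X {1..n}"
    and "\<S> \<noteq> {}"
    and "countable \<S>"
    and "\<And>s k. s \<in> \<S> \<Longrightarrow> k \<in> {1..n} \<Longrightarrow> s k \<in> borel_measurable borel"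
    and "\<And>s k x. s \<in> \<S> \<Longrightarrow> k \<in> {1..n} \<Longrightarrow> s k x \<in> {-1..1}"
    and "\<And>s k. s \<in> \<S> \<Longrightarrow> k \<in> {1..n} \<Longrightarrow> prob_space.expectation M (\<lambda>\<omega>. s k (X k \<omega>)) = 0"
  shows "let Z = emp_sup n X \<S>; EZ = prob_space.expectation M Z; v = var_factor M n X \<S> in
    (\<forall>t>0. log_laplace M Z (- t) \<le> - t * EZ + v / 9 * (exp (3 * t) - 3 * t - 1)) \<and>
    (\<forall>x>0. prob_space.prob M {\<omega> \<in> space M. Z \<omega> \<le> EZ - x} \<le> bennett_bound v x) \<and>
    (\<forall>x>0. prob_space.prob M {\<omega> \<in> space M. Z \<omega> \<le> EZ - x}
             \<le> exp (- (x\<^sup>2 / (v + sqrt (v\<^sup>2 + 2 * v * x) + x))) \<and>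
           exp (- (x\<^sup>2 / (v + sqrt (v\<^sup>2 + 2 * v * x) + x))) \<le> exp (- (x\<^sup>2 / (2 * v + 2 * x))))"
proof -
  interpret prob_space M by fact
  note One_nat_def [simp del]
  let ?I = "{1..n}"
  let ?Z = "emp_sup n X \<S>" and ?V = "max_variance M n X \<S>"
  \<comment> \<open>The laws of the variables, completed by point masses outside
    \<open>{1..n}\<close> because the locale wants a probability measure at every index.\<close>
  define N where "N k = (if k \<in> ?I then distr M borel (X k) else return borel undefined)" for k
  define T where "T \<omega> = (\<lambda>k\<in>?I. X k \<omega>)" for \<omega>
  let ?P = "Pi\<^sub>M ?I N"
  have X[measurable]: "X k \<in> borel_measurable M" if "k \<in> ?I" for k
    using assms(3) that by (simp add: indep_vars_def)
  have sets_N[measurable_cong, simp]: "sets (N k) = sets borel" for k by (simp add: N_def)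
  have space_N[simp]: "space (N k) = UNIV" for k by (simp add: N_def)
  have N_prob: "prob_space (N k)" for k
    unfolding N_def by (auto intro!: prob_space_distr prob_space_return)
  have sets_P: "sets ?P = sets (Pi\<^sub>M ?I (\<lambda>_. borel))" by (rule sets_PiM_cong) auto
  have T_meas: "T \<in> M \<rightarrow>\<^sub>M ?P"
    unfolding T_def by (rule measurable_restrict) measurable
  \<comment> \<open>Independence enters here: the joint law of the variables is the product of their
    laws.\<close>
  have "distr M (Pi\<^sub>M ?I (\<lambda>_. borel)) T = Pi\<^sub>M ?I (\<lambda>k. distr M borel (X k))"
    using assms(2,3) indep_vars_iff_distr_eq_PiM'[where I = ?I and M' = "\<lambda>_. borel" and X = X] unfolding T_def by auto
  also have "\<dots> = ?P" by (intro PiM_cong) (auto simp: N_def)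
  also have "distr M (Pi\<^sub>M ?I (\<lambda>_. borel)) T = distr M ?P T"
    by (rule distr_cong[OF refl sets_P[symmetric] refl])
  finally have distr_T: "distr M ?P T = ?P" .
  have int_P: "(\<integral>x. g x \<partial>?P) = (\<integral>\<omega>. g (T \<omega>) \<partial>M)" if "g \<in> borel_measurable ?P" for g :: "_ \<Rightarrow> real"
    using integral_distr[OF T_meas that] unfolding distr_T .
  have int_N: "(\<integral>y. g y \<partial>N k) = (\<integral>\<omega>. g (X k \<omega>) \<partial>M)"
    if "k \<in> ?I" "g \<in> borel_measurable borel" for g :: "_ \<Rightarrow> real" and k
    using integral_distr[OF X[OF that(1)] that(2)] that(1) by (simp add: N_def)
  have centered: "centered_class N ?I \<S> V"
    if "\<And>s. s \<in> \<S> \<Longrightarrow> (\<Sum>k\<in>?I. \<integral>y. (s k y)\<^sup>2 \<partial>N k) \<le> V" for V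
  proof (intro centered_class.intro finite_product_prob.intro centered_class_axioms.intro)
    show "prob_space (N k)" for k by (rule N_prob)
    show "?I \<noteq> {}" using assms(2) by simp
    show "s k \<in> borel_measurable (N k)" if "s \<in> \<S>" "k \<in> ?I" for s k
      using assms(6)[OF that] measurable_cong_sets[OF sets_N refl] by blast
    show "\<bar>s k y\<bar> \<le> 1" if "s \<in> \<S>" "k \<in> ?I" "y \<in> space (N k)" for s k y
      using assms(7)[OF that(1,2), of y] by auto
    show "(\<integral>y. s k y \<partial>N k) = 0" if "s \<in> \<S>" "k \<in> ?I" for s k
      using int_N[OF that(2) assms(6)[OF that]] assms(8)[OF that] by simp
  qed (use assms that in auto)
  have "(\<Sum>k\<in>?I. \<integral>y. (s k y)\<^sup>2 \<partial>N k) \<le> (\<Sum>k\<in>?I. 1)" if "s \<in> \<S>" for s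
  proof (rule sum_mono)
    fix k assume k: "k \<in> ?I"
    have "s k \<in> borel_measurable (N k)"
      using assms(6)[OF that k] measurable_cong_sets[OF sets_N refl] by blast
    then show "(\<integral>y. (s k y)\<^sup>2 \<partial>N k) \<le> 1"
      by (intro prob_space.integral_between[OF N_prob, of _ _ 0])
        (use assms(7)[OF that k] in \<open>auto simp: abs_square_le_1 abs_le_iff minus_le_iff\<close>)
  qed
  \<comment> \<open>This instance with the crude variance bound \<open>n\<close> only serves to identify the variances, so
    that \<open>max_variance\<close> can be used as the bound in the second one.\<close>
  then interpret C: centered_class N ?I \<S> "real n" by (intro centered) simp
  have emp_sum_T: "emp_sum n X s = (\<lambda>\<omega>. C.part_sum s (T \<omega>))" for s
    by (auto simp: emp_sum_def C.part_sum_def T_def intro!: sum.cong)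
  have Z_T: "?Z = (\<lambda>\<omega>. C.Z (T \<omega>))"
    by (simp add: fun_eq_iff emp_sup_def C.Z_def emp_sum_T)
  have var: "variance (emp_sum n X s) = (\<Sum>k\<in>?I. \<integral>y. (s k y)\<^sup>2 \<partial>N k)" if s: "s \<in> \<S>" for s
  proof -
    note m = C.part_sum_measurable[OF s]
    have "expectation (emp_sum n X s) = 0"
      using int_P[OF m] C.integral_part_sum[OF s] by (simp add: emp_sum_T)
    moreover have "expectation (\<lambda>\<omega>. (emp_sum n X s \<omega>)\<^sup>2) = (\<integral>x. (C.part_sum s x)\<^sup>2 \<partial>?P)"
      using int_P[OF borel_measurable_power[OF m]] by (simp add: emp_sum_T)
    ultimately show ?thesis using C.integral_part_sum_square[OF s] by simp
  qed
  \<comment> \<open>Boundedness makes \<open>max_variance\<close> a true upper bound, admissible as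
    \<open>V\<close>.\<close>
  have "bdd_above ((\<lambda>s. variance (emp_sum n X s)) ` \<S>)"
    by (rule bdd_aboveI2[where M = "real n"]) (use C.V in \<open>simp add: var\<close>)
  then have "(\<Sum>k\<in>?I. \<integral>y. (s k y)\<^sup>2 \<partial>N k) \<le> ?V" if "s \<in> \<S>" for s
    unfolding max_variance_def var[OF that, symmetric] using that by (intro cSUP_upper)
  then interpret D: centered_class N ?I \<S> ?V by (rule centered)

  let ?EZ = "expectation ?Z" and ?v = "var_factor M n X \<S>"
  have EZ: "?EZ = (\<integral>x. C.Z x \<partial>?P)"
    using int_P[OF C.Z_measurable] by (simp add: Z_T)
  have v: "?v = 2 * ?EZ + ?V" by (simp add: var_factor_def)
  have v0: "0 \<le> ?v" unfolding v EZ using C.integral_Z_nonneg D.V_nonneg by simp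
  have EexpZ: "(\<integral>\<omega>. exp (- t * ?Z \<omega>) \<partial>M) = (\<integral>x. exp (- t * C.Z x) \<partial>?P)" for t
    using int_P[of "\<lambda>x. exp (- t * C.Z x)"] C.Z_measurable by (simp add: Z_T)
  \<comment> \<open>The definition of \<open>Z\<close> does not involve \<open>V\<close>, so the
    bound from the second instance speaks about the same supremum.\<close>
  have L: "ln (\<integral>\<omega>. exp (- t * ?Z \<omega>) \<partial>M) \<le> - t * ?EZ + ?v * laplace_bound t" if "0 < t" for t
    unfolding EexpZ EZ v using D.log_laplace_Z_le[OF that] .
  have int: "integrable M (\<lambda>\<omega>. exp (- t * ?Z \<omega>))" for t
    using integrable_distr[OF T_meas, unfolded distr_T, OF C.integrable_exp_Z[of t]]
    by (simp add: Z_T)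
  \<comment> \<open>The premise \<open>0 < t\<close> appears twice in \<open>tail\<close>: once from
    \<open>L\<close> and once from Chernoff's bound.\<close>
  note tail = laplace_tail_bound[OF int L]
  \<comment> \<open>For \<open>?v = 0\<close> the tail is at most \<open>exp (- t * x)\<close> for
    every \<open>t > 0\<close>. If it were positive, \<open>t = ln (2 / ?p) / x\<close> would give
    \<open>?p \<le> ?p / 2\<close>; the 2 keeps \<open>t\<close> positive even when
    \<open>?p = 1\<close>.\<close>
  have tail_0: "prob {\<omega> \<in> space M. ?Z \<omega> \<le> ?EZ - x} = 0" if "?v = 0" "0 < x" for x
  proof (rule ccontr)
    let ?p = "prob {\<omega> \<in> space M. ?Z \<omega> \<le> ?EZ - x}"
    assume "?p \<noteq> 0"
    then have p: "0 < ?p" by (simp add: zero_less_measure_iff)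
    moreover have "?p < 2" by (rule order_le_less_trans[OF prob_le_1]) simp
    ultimately have "1 < 2 / ?p" by (simp add: less_divide_eq)
    then have t: "0 < ln (2 / ?p) / x" using \<open>0 < x\<close> by (intro divide_pos_pos ln_gt_zero)
    have "?p \<le> exp (- ln (2 / ?p))"
      using tail[OF t t, of x] that by simp
    also have "\<dots> = ?p / 2" using p by (simp add: exp_minus)
    finally show False using p by simp
  qed
  have a: "log_laplace M ?Z (- t) \<le> - t * ?EZ + ?v / 9 * (exp (3 * t) - 3 * t - 1)" if "0 < t" for t
    using L[OF that] by (simp add: log_laplace_def laplace_bound_def)
  have b: "prob {\<omega> \<in> space M. ?Z \<omega> \<le> ?EZ - x} \<le> bennett_bound ?v x" if x: "0 < x" for x
  proof (cases "?v = 0")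
    case True
    then show ?thesis using tail_0[OF True x] by (simp add: bennett_bound_def)
  next
    case False
    then have v: "0 < ?v" using v0 by simp
    show ?thesis
      using tail[OF bennett_exponent(1)[OF v x] bennett_exponent(1)[OF v x], of x]
      unfolding bennett_exponent(2)[OF v x] using False by (simp add: bennett_bound_def)
  qed
  have c: "prob {\<omega> \<in> space M. ?Z \<omega> \<le> ?EZ - x} \<le> exp (- (x\<^sup>2 / (?v + sqrt (?v\<^sup>2 + 2 * ?v * x) + x)))"
    if x: "0 < x" for x
  proof (cases "?v = 0")
    case True
    then show ?thesis using tail_0[OF True x] by simp
  next
    case False
    then have v: "0 < ?v" using v0 by simp
    obtain t where t: "0 < t"
      "?v * laplace_bound t - t * x \<le> - (x\<^sup>2 / (?v + sqrt (?v\<^sup>2 + 2 * ?v * x) + x))"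
      using bernstein_exponent[OF v x] by blast
    show ?thesis using tail[OF t(1) t(1), of x] t(2) by (meson exp_le_cancel_iff order_trans)
  qed
  show ?thesis
    unfolding Let_def using a b c bernstein_bound_mono[OF v0] by blast
qed

end
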